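(* \textsc{MinCostCFD} can be solved in polynomial time on instances where the network is bichromatic (its arcs use at most two colours) and the $(s,t)$-flow $x$ is $\lambda$-uniform for some $\lambda>0$.
   Context: An arc-coloured (multi)digraph $D=(V,A,c)$ has an arc colouring $c:A\to\{1,\dots,p\}$ (not necessarily proper). A network $\mathcal{N}=(D,u)$ has capacities $u:A\to\mathbb{R}_+$; a flow satisfies $0\le x\le u$; an $(s,t)$-flow satisfies flow conservation at every vertex other than $s,t$, with value $|x|$ the net flow out of $s$. A flow $x$ is $\lambda$-uniform if $x(a)\in\{0,\lambda\}$ for every arc $a$. A path flow along a directed path $P$ is a flow equal to a constant $r>0$ on arcs of $P$ and $0$ elsewhere; cycle flows are defined analogously. A decomposition of an $(s,t)$-flow $x$ is a family of path flows $x^1,\dots,x^\ell$ along directed $(s,t)$-paths $P_1,\dots,P_\ell$, together possibly with cycle flows, whose arc-wise sum is $x$; its cost is $\sum_{i=1}^\ell n_c(P_i)$, where $n_c(P)$ is the number of distinct colours on the arcs of $P$. \textsc{MinCostCFD}: given an arc-coloured network, vertices $s,t$ and an $(s,t)$-flow $x$, find a decomposition of $x$ into $(s,t)$-path flows of minimum cost. *)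

theory Defs
  imports
    Complex_Main
    "HOL-Library.Log_Nat"
    "HOL-Computational_Algebra.Polynomial"
    "Graph_Theory.Arc_Walk"
begin

section \<open>Polynomial-time computation\<close>

text \<open>
  The machine model is a variable-free while language over S-expressions whose atoms are numbers.
  Besides building and inspecting pairs, a program can only test for equality, add, subtract and
  compare numbers, and write down the numbers 0 and 1. In particular there are no further real
  constants (which could carry advice), and there is neither multiplication nor rounding.

  The size of a number is given by a parameter \<open>w\<close>, and each primitive step is charged the size of
  the whole value it is applied to. There are two instances:

  \<^item> \<open>w = unit_size\<close>: arbitrary real numbers as atoms of size 1. This is the additive real machine,
    and the size of an input is the combinatorial one. All other data are still charged by their
    size, so that repeated duplication of a value is not free.
  \<^item> \<open>w = bit_size\<close>: rational numbers, in binary. This is the logarithmic cost model, which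
    is polynomially equivalent to Turing machines. Rationality is preserved by all primitives.
\<close>

datatype sexp = Emp | Num real | Pr sexp sexp

datatype prim =
  Ident | MkEmp | MkZero | MkOne | Fst | Snd | IsNum | Equal | Add | Sub | Less

datatype prog =
    Prim prim
  | Fork prog prog
  | Seq prog prog
  | Cond prog prog prog
  | While prog prog

text \<open>\<open>Emp\<close> counts as false, everything else as true.\<close>

definition enc_bool :: "bool \<Rightarrow> sexp" where
  "enc_bool b = (if b then Num 1 else Emp)"

fun prim_val :: "prim \<Rightarrow> sexp \<Rightarrow> sexp" where
  "prim_val Ident v = v"
| "prim_val MkEmp v = Emp"
| "prim_val MkZero v = Num 0"
| "prim_val MkOne v = Num 1"
| "prim_val Fst (Pr a b) = a"
| "prim_val Snd (Pr a b) = b"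
| "prim_val IsNum (Num r) = enc_bool True"
| "prim_val Equal (Pr a b) = enc_bool (a = b)"
| "prim_val Add (Pr (Num r) (Num q)) = Num (r + q)"
| "prim_val Sub (Pr (Num r) (Num q)) = Num (r - q)"
| "prim_val Less (Pr (Num r) (Num q)) = enc_bool (r < q)"
| "prim_val _ _ = Emp"

fun ssize :: "(real \<Rightarrow> nat) \<Rightarrow> sexp \<Rightarrow> nat" where
  "ssize w Emp = 1"
| "ssize w (Num r) = w r"
| "ssize w (Pr a b) = 1 + ssize w a + ssize w b"

definition unit_size :: "real \<Rightarrow> nat" where
  "unit_size r = 1"

text \<open>Only meaningful for rational arguments.\<close>

definition bit_size :: "real \<Rightarrow> nat" where
  "bit_size r = (case quotient_of (inv of_rat r) of
     (p, q) \<Rightarrow> 1 + floorlog 2 (nat \<bar>p\<bar>) + floorlog 2 (nat q))"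

text \<open>\<open>exec w P v v' n\<close>: on input \<open>v\<close>, program \<open>P\<close> halts with output \<open>v'\<close> at cost \<open>n\<close>.\<close>

inductive exec :: "(real \<Rightarrow> nat) \<Rightarrow> prog \<Rightarrow> sexp \<Rightarrow> sexp \<Rightarrow> nat \<Rightarrow> bool" for w where
  Prim: "exec w (Prim f) v (prim_val f v) (1 + ssize w v)"
| Fork: "exec w P v a m \<Longrightarrow> exec w Q v b n \<Longrightarrow> exec w (Fork P Q) v (Pr a b) (1 + m + n)"
| Seq: "exec w P v a m \<Longrightarrow> exec w Q a b n \<Longrightarrow> exec w (Seq P Q) v b (1 + m + n)"
| CondT: "exec w B v c m \<Longrightarrow> c \<noteq> Emp \<Longrightarrow> exec w P v a n \<Longrightarrow>
    exec w (Cond B P Q) v a (1 + m + n)"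
| CondF: "exec w B v Emp m \<Longrightarrow> exec w Q v a n \<Longrightarrow> exec w (Cond B P Q) v a (1 + m + n)"
| WhileF: "exec w B v Emp m \<Longrightarrow> exec w (While B P) v v (1 + m)"
| WhileT: "exec w B v c m \<Longrightarrow> c \<noteq> Emp \<Longrightarrow> exec w P v a n \<Longrightarrow> exec w (While B P) a b k \<Longrightarrow>
    exec w (While B P) v b (1 + m + n + k)"

inductive_cases exec_PrimE: "exec w (Prim f) v a n"
inductive_cases exec_ForkE: "exec w (Fork P Q) v a n"
inductive_cases exec_SeqE: "exec w (Seq P Q) v a n"
inductive_cases exec_CondE: "exec w (Cond B P Q) v a n"
inductive_cases exec_WhileE: "exec w (While B P) v a n"

lemma exec_deterministic:
  assumes "exec w P v a m" and "exec w P v b n"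
  shows "a = b \<and> m = n"
  using assms
proof (induction arbitrary: b n rule: exec.induct)
  case Prim
  then show ?case by (auto elim: exec_PrimE)
next
  case Fork
  from Fork.prems show ?case by (rule exec_ForkE) (auto dest!: Fork.IH)
next
  case Seq
  from Seq.prems show ?case by (rule exec_SeqE) (auto dest!: Seq.IH)
next
  case CondT
  from CondT.prems show ?case by (rule exec_CondE) (auto dest!: CondT.IH simp: CondT.hyps)+
next
  case CondF
  from CondF.prems show ?case by (rule exec_CondE) (auto dest!: CondF.IH)+
next
  case WhileF
  from WhileF.prems show ?case by (rule exec_WhileE) (auto dest!: WhileF.IH)+
next
  case WhileT
  from WhileT.prems show ?case by (rule exec_WhileE) (auto dest!: WhileT.IH simp: WhileT.hyps)+
qed

text \<open>
  Some program computes, for each input in \<open>K\<close>, an output related to it by \<open>sol\<close>, at a cost that is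
  polynomially bounded in the size of the encoded input.
\<close>

definition poly_time_solvable ::
  "(real \<Rightarrow> nat) \<Rightarrow> ('i \<Rightarrow> sexp) \<Rightarrow> ('o \<Rightarrow> sexp) \<Rightarrow> ('i \<Rightarrow> 'o \<Rightarrow> bool) \<Rightarrow> 'i set \<Rightarrow> bool" where
  "poly_time_solvable w enc_in enc_out sol K \<longleftrightarrow>
     (\<exists>P (q :: nat poly). \<forall>I\<in>K. \<exists>out n.
        exec w P (enc_in I) (enc_out out) n \<and>
        n \<le> poly q (ssize w (enc_in I)) \<and>
        sol I out)"

definition enc_nat :: "nat \<Rightarrow> sexp" where
  "enc_nat n = Num (real n)"

definition enc_list :: "('a \<Rightarrow> sexp) \<Rightarrow> 'a list \<Rightarrow> sexp" where
  "enc_list f xs = foldr (\<lambda>x. Pr (f x)) xs Emp"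

fun enc_option :: "('a \<Rightarrow> sexp) \<Rightarrow> 'a option \<Rightarrow> sexp" where
  "enc_option f None = Emp"
| "enc_option f (Some x) = Pr Emp (f x)"


section \<open>Flows and their decompositions\<close>

definition is_flow :: "('v, 'a) pre_digraph \<Rightarrow> ('a \<Rightarrow> real) \<Rightarrow> ('a \<Rightarrow> real) \<Rightarrow> bool" where
  "is_flow G u x \<longleftrightarrow> (\<forall>a\<in>arcs G. 0 \<le> x a \<and> x a \<le> u a)"

definition is_st_flow ::
  "('v, 'a) pre_digraph \<Rightarrow> ('a \<Rightarrow> real) \<Rightarrow> 'v \<Rightarrow> 'v \<Rightarrow> ('a \<Rightarrow> real) \<Rightarrow> bool" where
  "is_st_flow G u s t x \<longleftrightarrow> is_flow G u x \<and>
     (\<forall>v \<in> verts G - {s, t}. sum x (in_arcs G v) = sum x (out_arcs G v))"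

definition uniform_flow :: "('v, 'a) pre_digraph \<Rightarrow> real \<Rightarrow> ('a \<Rightarrow> real) \<Rightarrow> bool" where
  "uniform_flow G l x \<longleftrightarrow> (\<forall>a\<in>arcs G. x a \<in> {0, l})"

definition const_flow :: "'a list \<Rightarrow> real \<Rightarrow> 'a \<Rightarrow> real" where
  "const_flow P r a = (if a \<in> set P then r else 0)"

text \<open>
  A decomposition consists of a list of path flows and a list of cycle flows, each given by the arc
  list of the path or cycle and the value on it. The capacity constraints for the individual path
  and cycle flows follow from those for their sum.
\<close>

type_synonym 'a decomposition = "('a list \<times> real) list \<times> ('a list \<times> real) list"

definition is_decomposition ::
  "('v, 'a) pre_digraph \<Rightarrow> 'v \<Rightarrow> 'v \<Rightarrow> ('a \<Rightarrow> real) \<Rightarrow> 'a decomposition \<Rightarrow> bool" where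
  "is_decomposition G s t x d \<longleftrightarrow>
     (\<forall>(P, r)\<in>set (fst d). pre_digraph.apath G s P t \<and> 0 < r) \<and>
     (\<forall>(C, r)\<in>set (snd d). pre_digraph.cycle G C \<and> 0 < r) \<and>
     (\<forall>a\<in>arcs G. x a = (\<Sum>(P, r)\<leftarrow>fst d. const_flow P r a) + (\<Sum>(C, r)\<leftarrow>snd d. const_flow C r a))"

definition num_colours :: "('a \<Rightarrow> nat) \<Rightarrow> 'a list \<Rightarrow> nat" where
  "num_colours c P = card (c ` set P)"

definition decomposition_cost :: "('a \<Rightarrow> nat) \<Rightarrow> 'a decomposition \<Rightarrow> nat" where
  "decomposition_cost c d = (\<Sum>(P, r)\<leftarrow>fst d. num_colours c P)"

definition is_min_cost_decomposition ::
  "('v, 'a) pre_digraph \<Rightarrow> ('a \<Rightarrow> nat) \<Rightarrow> 'v \<Rightarrow> 'v \<Rightarrow> ('a \<Rightarrow> real) \<Rightarrow> 'a decomposition \<Rightarrow> bool" where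
  "is_min_cost_decomposition G c s t x d \<longleftrightarrow> is_decomposition G s t x d \<and>
     (\<forall>d'. is_decomposition G s t x d' \<longrightarrow> decomposition_cost c d \<le> decomposition_cost c d')"


section \<open>The computational problem\<close>

text \<open>As inputs to an algorithm, vertices and arcs are named by natural numbers.\<close>

record cfd_instance =
  graph :: "(nat, nat) pre_digraph"
  ncolours :: nat
  colour :: "nat \<Rightarrow> nat"
  capacity :: "nat \<Rightarrow> real"
  source :: nat
  sink :: nat
  flow :: "nat \<Rightarrow> real"

definition cfd_instances :: "cfd_instance set" where
  "cfd_instances = {I.
     fin_digraph (graph I) \<and>
     colour I ` arcs (graph I) \<subseteq> {1..ncolours I} \<and>
     (\<forall>a\<in>arcs (graph I). 0 \<le> capacity I a) \<and>
     source I \<in> verts (graph I) \<and> sink I \<in> verts (graph I) \<and>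
     is_st_flow (graph I) (capacity I) (source I) (sink I) (flow I)}"

definition bichromatic :: "cfd_instance \<Rightarrow> bool" where
  "bichromatic I \<longleftrightarrow> card (colour I ` arcs (graph I)) \<le> 2"

definition rational_instance :: "cfd_instance \<Rightarrow> bool" where
  "rational_instance I \<longleftrightarrow> (\<forall>a\<in>arcs (graph I). capacity I a \<in> \<rat> \<and> flow I a \<in> \<rat>)"

definition enc_arc :: "cfd_instance \<Rightarrow> nat \<Rightarrow> sexp" where
  "enc_arc I a = enc_list id
     [enc_nat a, enc_nat (tail (graph I) a), enc_nat (head (graph I) a), enc_nat (colour I a),
      Num (capacity I a), Num (flow I a)]"

definition enc_instance :: "cfd_instance \<Rightarrow> sexp" where
  "enc_instance I = enc_list id
     [enc_list enc_nat (sorted_list_of_set (verts (graph I))),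
      enc_list (enc_arc I) (sorted_list_of_set (arcs (graph I))),
      enc_nat (ncolours I), enc_nat (source I), enc_nat (sink I)]"

definition enc_weighted_list :: "(nat list \<times> real) list \<Rightarrow> sexp" where
  "enc_weighted_list = enc_list (\<lambda>(P, r). Pr (enc_list enc_nat P) (Num r))"

definition enc_decomposition :: "nat decomposition \<Rightarrow> sexp" where
  "enc_decomposition d = Pr (enc_weighted_list (fst d)) (enc_weighted_list (snd d))"

text \<open>
  The answer \<open>None\<close> is correct exactly if there is no decomposition at all, which happens
  if the net flow out of the source is negative.
\<close>

fun min_cost_cfd :: "cfd_instance \<Rightarrow> nat decomposition option \<Rightarrow> bool" where
  "min_cost_cfd I None \<longleftrightarrow>
     (\<nexists>d. is_decomposition (graph I) (source I) (sink I) (flow I) d)"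
| "min_cost_cfd I (Some d) \<longleftrightarrow>
     is_min_cost_decomposition (graph I) (colour I) (source I) (sink I) (flow I) d"

definition min_cost_cfd_poly_time_on :: "(real \<Rightarrow> nat) \<Rightarrow> cfd_instance set \<Rightarrow> bool" where
  "min_cost_cfd_poly_time_on w K \<longleftrightarrow>
     poly_time_solvable w enc_instance (enc_option enc_decomposition) min_cost_cfd K"

end

theory Submission
  imports Defs
begin

text \<open>
  Scale the flow so that it is the characteristic function of an arc set \<open>B\<close>, of value \<open>k\<close>. In a
  decomposition the path values add up to \<open>k\<close> and are at most 1; a path costs 1 if it is
  monochromatic and 2 otherwise. The monochromatic paths of colour \<open>c\<close> form a flow in the arcs of
  colour \<open>c\<close>, so their total value is at most the maximum flow value \<open>M c\<close> there. Hence every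
  decomposition costs at least \<open>k\<close> and at least \<open>2 * k - (\<Sum>c. M c)\<close>. Conversely, integral maximum
  flows in the colour classes are arc-disjoint and consist of monochromatic paths; keep at most \<open>k\<close>
  of these and decompose the remaining flow into further paths and cycles. The cap at \<open>k\<close> is needed
  because the flow may also run from the sink back to the source.

  The algorithm never calculates: numbers are only compared for equality, and \<open>k\<close> is kept in unary.
  Therefore its running time is polynomial for every way of measuring the size of numbers.
\<close>

section \<open>Polynomial-time functions on encodable types\<close>

class encodable =
  fixes encode :: "'a \<Rightarrow> sexp"
  assumes encode_eq_iff [simp]: "encode x = encode y \<longleftrightarrow> x = y"

instantiation nat :: encodable
begin
definition [simp]: "encode = enc_nat"
instance by standard (simp add: enc_nat_def)
end

instantiation real :: encodable
begin
definition [simp]: "encode = Num"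
instance by standard simp
end

instantiation bool :: encodable
begin
definition [simp]: "encode = enc_bool"
instance by standard (auto simp: enc_bool_def)
end

instantiation unit :: encodable
begin
definition [simp]: "encode (u :: unit) = Emp"
instance by standard simp
end

instantiation prod :: (encodable, encodable) encodable
begin
definition encode_prod [simp]: "encode p = Pr (encode (fst p)) (encode (snd p))"
instance by standard (auto simp: prod_eq_iff)
end

instantiation list :: (encodable) encodable
begin
definition encode_list_eq: "encode = enc_list encode"
instance
proof
  fix xs ys :: "'a list"
  show "encode xs = encode ys \<longleftrightarrow> xs = ys"
    unfolding encode_list_eq enc_list_def
  proof (induction xs arbitrary: ys)
    case Nil
    then show ?case by (cases ys) auto
  next
    case (Cons x xs)
    then show ?case by (cases ys) auto
  qed
qed
end

instantiation option :: (encodable) encodable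
begin
definition [simp]: "encode = enc_option encode"
instance
proof
  fix x y :: "'a option"
  show "encode x = encode y \<longleftrightarrow> x = y"
    by (cases x; cases y) auto
qed
end

lemma encode_Nil [simp]: "encode [] = Emp"
  and encode_Cons [simp]: "encode (x # xs) = Pr (encode x) (encode xs)"
  by (simp_all add: encode_list_eq enc_list_def)

abbreviation esize :: "(real \<Rightarrow> nat) \<Rightarrow> 'a::encodable \<Rightarrow> nat" where
  "esize w x \<equiv> ssize w (encode x)"

lemma length_le_esize: "length xs \<le> esize w xs"
  by (induction xs) auto

lemma esize_member: "x \<in> set xs \<Longrightarrow> esize w x \<le> esize w xs"
  by (induction xs) auto

lemma poly_nat_mono: "m \<le> n \<Longrightarrow> poly q m \<le> poly q n" for m n :: nat
  by (induction q) (auto intro: add_mono mult_mono)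

named_theorems ptime_intros

definition ptime :: "(real \<Rightarrow> nat) \<Rightarrow> ('a::encodable \<Rightarrow> 'b::encodable) \<Rightarrow> bool" where
  "ptime w f \<longleftrightarrow> (\<exists>P q. \<forall>x. \<exists>n. exec w P (encode x) (encode (f x)) n \<and>
     n + esize w (f x) \<le> poly q (esize w x))"

lemma ptimeE:
  assumes "ptime w f"
  obtains P q where "\<And>x. \<exists>n. exec w P (encode x) (encode (f x)) n \<and>
     n + esize w (f x) \<le> poly q (esize w x)"
  using assms unfolding ptime_def by blast

lemma ptime_comp:
  assumes "ptime w g" "ptime w f"
  shows "ptime w (\<lambda>x. g (f x))"
proof -
  obtain P p where P: "\<And>x. \<exists>n. exec w P (encode x) (encode (f x)) n \<and>
     n + esize w (f x) \<le> poly p (esize w x)"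
    using assms(2) by (rule ptimeE) blast
  obtain Q q where Q: "\<And>x. \<exists>n. exec w Q (encode x) (encode (g x)) n \<and>
     n + esize w (g x) \<le> poly q (esize w x)"
    using assms(1) by (rule ptimeE) blast
  have "\<exists>n. exec w (Seq P Q) (encode x) (encode (g (f x))) n \<and>
     n + esize w (g (f x)) \<le> poly (1 + p + pcompose q p) (esize w x)" for x
  proof -
    obtain m where m: "exec w P (encode x) (encode (f x)) m" "m + esize w (f x) \<le> poly p (esize w x)"
      using P by blast
    obtain n where n: "exec w Q (encode (f x)) (encode (g (f x))) n"
      "n + esize w (g (f x)) \<le> poly q (esize w (f x))"
      using Q by blast
    have "poly q (esize w (f x)) \<le> poly q (poly p (esize w x))"
      using m(2) by (intro poly_nat_mono) simp
    then show ?thesis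
      using exec.Seq[OF m(1) n(1)] m(2) n(2)
      by (intro exI[of _ "1 + m + n"]) (simp add: poly_pcompose)
  qed
  then show ?thesis
    unfolding ptime_def by blast
qed

lemma ptime_Pair [ptime_intros]:
  assumes "ptime w f" "ptime w g"
  shows "ptime w (\<lambda>x. (f x, g x))"
proof -
  obtain P p where P: "\<And>x. \<exists>n. exec w P (encode x) (encode (f x)) n \<and>
     n + esize w (f x) \<le> poly p (esize w x)"
    using assms(1) by (rule ptimeE) blast
  obtain Q q where Q: "\<And>x. \<exists>n. exec w Q (encode x) (encode (g x)) n \<and>
     n + esize w (g x) \<le> poly q (esize w x)"
    using assms(2) by (rule ptimeE) blast
  have "\<exists>n. exec w (Fork P Q) (encode x) (encode (f x, g x)) n \<and>
     n + esize w (f x, g x) \<le> poly (2 + p + q) (esize w x)" for x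
  proof -
    obtain m where m: "exec w P (encode x) (encode (f x)) m" "m + esize w (f x) \<le> poly p (esize w x)"
      using P by blast
    obtain n where n: "exec w Q (encode x) (encode (g x)) n"
      "n + esize w (g x) \<le> poly q (esize w x)"
      using Q by blast
    show ?thesis
      using exec.Fork[OF m(1) n(1)] m(2) n(2)
      by (intro exI[of _ "1 + m + n"]) simp
  qed
  then show ?thesis
    unfolding ptime_def by blast
qed

lemma ptime_If [ptime_intros]:
  assumes "ptime w b" "ptime w f" "ptime w g"
  shows "ptime w (\<lambda>x. if b x then f x else g x)"
proof -
  obtain B r where B: "\<And>x. \<exists>n. exec w B (encode x) (encode (b x)) n \<and>
     n + esize w (b x) \<le> poly r (esize w x)"
    using assms(1) by (rule ptimeE) blast
  obtain P p where P: "\<And>x. \<exists>n. exec w P (encode x) (encode (f x)) n \<and>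
     n + esize w (f x) \<le> poly p (esize w x)"
    using assms(2) by (rule ptimeE) blast
  obtain Q q where Q: "\<And>x. \<exists>n. exec w Q (encode x) (encode (g x)) n \<and>
     n + esize w (g x) \<le> poly q (esize w x)"
    using assms(3) by (rule ptimeE) blast
  have "\<exists>n. exec w (Cond B P Q) (encode x) (encode (if b x then f x else g x)) n \<and>
     n + esize w (if b x then f x else g x) \<le> poly (1 + r + p + q) (esize w x)" for x
  proof -
    obtain k where k: "exec w B (encode x) (encode (b x)) k" "k + esize w (b x) \<le> poly r (esize w x)"
      using B by blast
    obtain m where m: "exec w P (encode x) (encode (f x)) m" "m + esize w (f x) \<le> poly p (esize w x)"
      using P by blast
    obtain n where n: "exec w Q (encode x) (encode (g x)) n"
      "n + esize w (g x) \<le> poly q (esize w x)"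
      using Q by blast
    show ?thesis
    proof (cases "b x")
      case True
      then show ?thesis
        using exec.CondT[OF k(1) _ m(1), of Q] k(2) m(2)
        by (intro exI[of _ "1 + k + m"]) (simp add: enc_bool_def)
    next
      case False
      then show ?thesis
        using exec.CondF[OF _ n(1), of B k P] k n(2)
        by (intro exI[of _ "1 + k + n"]) (simp add: enc_bool_def)
    qed
  qed
  then show ?thesis
    unfolding ptime_def by blast
qed

lemma ptime_prim:
  assumes "\<And>x. prim_val f (encode x) = encode (g x)" "\<And>x. esize w (g x) \<le> esize w x + k"
  shows "ptime w g"
proof -
  have "\<exists>n. exec w (Prim f) (encode x) (encode (g x)) n \<and>
     n + esize w (g x) \<le> poly [:k + 1, 2:] (esize w x)" for x
    using exec.Prim[of w f "encode x"] assms(1)[of x] assms(2)[of x]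
    by (intro exI[of _ "1 + esize w x"]) auto
  then show ?thesis
    unfolding ptime_def by blast
qed

lemma ptime_id [ptime_intros]: "ptime w (\<lambda>x. x)"
  by (rule ptime_prim[where f = Ident and k = 0]) auto

lemma ptime_fst [ptime_intros]: "ptime w f \<Longrightarrow> ptime w (\<lambda>x. fst (f x))"
  by (rule ptime_comp[of w fst], rule ptime_prim[where f = Fst and k = 0]) auto

lemma ptime_snd [ptime_intros]: "ptime w f \<Longrightarrow> ptime w (\<lambda>x. snd (f x))"
  by (rule ptime_comp[of w snd], rule ptime_prim[where f = Snd and k = 0]) auto

lemma ptime_Nil [ptime_intros]: "ptime w (\<lambda>x. [])"
  by (rule ptime_prim[where f = MkEmp and k = 1]) auto

lemma ptime_False [ptime_intros]: "ptime w (\<lambda>x. False)"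
  by (rule ptime_prim[where f = MkEmp and k = 1]) (auto simp: enc_bool_def)

lemma ptime_True [ptime_intros]: "ptime w (\<lambda>x. True)"
  by (rule ptime_prim[where f = MkOne and k = "w 1"]) (auto simp: enc_bool_def)

lemma ptime_zero_real [ptime_intros]: "ptime w (\<lambda>x. 0 :: real)"
  by (rule ptime_prim[where f = MkZero and k = "w 0"]) auto

lemma ptime_None [ptime_intros]: "ptime w (\<lambda>x. None)"
  by (rule ptime_prim[where f = MkEmp and k = 1]) auto

lemma ptime_Some [ptime_intros]: "ptime w f \<Longrightarrow> ptime w (\<lambda>x. Some (f x))"
proof -
  assume f: "ptime w f"
  have "ptime w (\<lambda>x. ())"
    by (rule ptime_prim[where f = MkEmp and k = 1]) auto
  from ptime_Pair[OF this f] show ?thesis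
    by (simp add: ptime_def)
qed

lemma ptime_Cons [ptime_intros]: "ptime w f \<Longrightarrow> ptime w g \<Longrightarrow> ptime w (\<lambda>x. f x # g x)"
  using ptime_Pair[of w f g] by (simp add: ptime_def)

lemma ptime_tl [ptime_intros]: "ptime w f \<Longrightarrow> ptime w (\<lambda>x. tl (f x))"
proof (rule ptime_comp[of w tl])
  have "prim_val Snd (encode xs) = encode (tl xs)" "esize w (tl xs) \<le> esize w xs + 0" for xs :: "'b list"
    by (cases xs; simp)+
  then show "ptime w (tl :: 'b list \<Rightarrow> _)"
    by (rule ptime_prim)
qed

lemma ptime_eq [ptime_intros]: "ptime w f \<Longrightarrow> ptime w g \<Longrightarrow> ptime w (\<lambda>x. f x = g x)"
proof -
  assume f: "ptime w f" and g: "ptime w g"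
  have "ptime w (\<lambda>p :: 'b \<times> 'b. fst p = snd p)"
    by (rule ptime_prim[where f = Equal and k = "w 1"]) (auto simp: enc_bool_def)
  from ptime_comp[OF this ptime_Pair[OF f g]] show ?thesis
    by simp
qed

text \<open>
  The accumulator may grow only by an amount that depends on the context and the current element, so
  that its size stays polynomial during a fold.
\<close>

definition grows :: "(real \<Rightarrow> nat) \<Rightarrow> ('c::encodable \<Rightarrow> 'x::encodable \<Rightarrow> 'a::encodable \<Rightarrow> 'a) \<Rightarrow> bool" where
  "grows w S \<longleftrightarrow> (\<exists>p. \<forall>c x a. esize w (S c x a) \<le> esize w a + poly p (esize w c + esize w x))"

lemma exec_fold_loop:
  fixes S :: "'c::encodable \<Rightarrow> 'x::encodable \<Rightarrow> 'a::encodable \<Rightarrow> 'a"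
  assumes Body: "\<And>x xs a. \<exists>n. exec w Q (encode (c, x # xs, a)) (encode (c, xs, S c x a)) n \<and>
      n \<le> poly q (esize w (c, x # xs, a))"
    and growth: "\<And>x a. x \<in> set xs \<Longrightarrow> esize w (S c x a) \<le> esize w a + K"
    and bound: "esize w (c, xs, a) + length xs * K \<le> N"
  shows "\<exists>n. exec w (While (Seq (Prim Snd) (Prim Fst)) Q)
      (encode (c, xs, a)) (encode (c, [] :: 'x list, fold (S c) xs a)) n \<and>
    n \<le> (length xs + 1) * (5 + 2 * N + poly q N) \<and>
    esize w (fold (S c) xs a) \<le> esize w a + length xs * K"
  using growth bound
proof (induction xs arbitrary: a)
  case Nil
  have "exec w (Seq (Prim Snd) (Prim Fst)) (encode (c, [] :: 'x list, a)) Emp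
    (1 + (1 + esize w (c, [] :: 'x list, a)) + (1 + esize w ([] :: 'x list, a)))"
    using exec.Seq[OF exec.Prim exec.Prim, of w Snd Fst "encode (c, [] :: 'x list, a)"] by simp
  from exec.WhileF[OF this, of Q] show ?case
    using Nil.prems(2) by (intro exI conjI) auto
next
  case (Cons x xs)
  let ?v = "encode (c, x # xs, a)"
  have v: "ssize w ?v \<le> N"
    using Cons.prems(2) by simp
  have test: "exec w (Seq (Prim Snd) (Prim Fst)) ?v (encode (x # xs))
    (1 + (1 + ssize w ?v) + (1 + esize w (x # xs, a)))"
    using exec.Seq[OF exec.Prim exec.Prim, of w Snd Fst ?v] by simp
  obtain m where m: "exec w Q ?v (encode (c, xs, S c x a)) m" "m \<le> poly q (ssize w ?v)"
    using Body by blast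
  have m': "m \<le> poly q N"
    using m(2) poly_nat_mono[OF v, of q] by simp
  have Sx: "esize w (S c x a) \<le> esize w a + K"
    using Cons.prems(1) by simp
  have "esize w (c, xs, S c x a) + length xs * K \<le> N"
    using Cons.prems(2) Sx by simp
  then obtain n where n: "exec w (While (Seq (Prim Snd) (Prim Fst)) Q)
      (encode (c, xs, S c x a)) (encode (c, [] :: 'x list, fold (S c) xs (S c x a))) n"
    "n \<le> (length xs + 1) * (5 + 2 * N + poly q N)"
    "esize w (fold (S c) xs (S c x a)) \<le> esize w (S c x a) + length xs * K"
    using Cons.IH[of "S c x a"] Cons.prems(1) by (meson list.set_intros(2))
  show ?case
  proof (intro exI conjI)
    show "exec w (While (Seq (Prim Snd) (Prim Fst)) Q) ?v
        (encode (c, [] :: 'x list, fold (S c) (x # xs) a))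
        (1 + (1 + (1 + ssize w ?v) + (1 + esize w (x # xs, a))) + m + n)"
      using exec.WhileT[OF test _ m(1) n(1)] by simp
    show "1 + (1 + (1 + ssize w ?v) + (1 + esize w (x # xs, a))) + m + n
        \<le> (length (x # xs) + 1) * (5 + 2 * N + poly q N)"
      using n(2) m' v by simp
    show "esize w (fold (S c) (x # xs) a) \<le> esize w a + length (x # xs) * K"
      using n(3) Sx by simp
  qed
qed

lemma ptime_fold:
  fixes S :: "'c::encodable \<Rightarrow> 'x::encodable \<Rightarrow> 'a::encodable \<Rightarrow> 'a"
  assumes S: "ptime w (\<lambda>p. S (fst p) (fst (snd p)) (snd (snd p)))" and "grows w S"
    and args: "ptime w c" "ptime w xs" "ptime w a"
  shows "ptime w (\<lambda>z. fold (S (c z)) (xs z) (a z))"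
proof -
  obtain p where p: "\<And>c x a. esize w (S c x a) \<le> esize w a + poly p (esize w c + esize w x)"
    using \<open>grows w S\<close> unfolding grows_def by blast
  \<comment> \<open>A nonempty list and the pair of its head and tail have the same encoding.\<close>
  have "ptime w (\<lambda>z :: 'c \<times> ('x \<times> 'x list) \<times> 'a.
    (fst z, snd (fst (snd z)), S (fst z) (fst (fst (snd z))) (snd (snd z))))"
    using ptime_comp[OF S, of "\<lambda>z :: 'c \<times> ('x \<times> 'x list) \<times> 'a.
      (fst z, fst (fst (snd z)), snd (snd z))"]
    by (simp add: ptime_Pair ptime_fst ptime_snd ptime_id)
  then obtain Q q where "\<And>z :: 'c \<times> ('x \<times> 'x list) \<times> 'a. \<exists>n. exec w Q (encode z)
      (encode (fst z, snd (fst (snd z)), S (fst z) (fst (fst (snd z))) (snd (snd z)))) n \<and>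
      n + esize w (fst z, snd (fst (snd z)), S (fst z) (fst (fst (snd z))) (snd (snd z)))
        \<le> poly q (esize w z)"
    by (rule ptimeE) blast
  from this[of "(_, (_, _), _)"] have Q: "\<exists>n. exec w Q (encode (c, x # xs, a)) (encode (c, xs, S c x a)) n \<and>
      n \<le> poly q (esize w (c, x # xs, a))" for c x xs a
    by fastforce
  define W where "W = While (Seq (Prim Snd) (Prim Fst)) Q"
  define N where "N = [:0, 1:] + [:0, 1:] * p"
  define r where "r = [:1, 1:] * (5 + 2 * N + pcompose q N) + 3 * N + 10"
  have "\<exists>n. exec w (Seq W (Seq (Prim Snd) (Prim Snd))) (encode z)
      (encode (fold (S (fst z)) (fst (snd z)) (snd (snd z)))) n \<and>
     n + esize w (fold (S (fst z)) (fst (snd z)) (snd (snd z))) \<le> poly r (esize w z)"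
    for z :: "'c \<times> 'x list \<times> 'a"
  proof -
    obtain c xs a where z: "z = (c, xs, a)"
      by (cases z) auto
    define b where "b = fold (S c) xs a"
    let ?N = "poly N (esize w z)"
    have len: "length xs \<le> esize w z"
      using length_le_esize[of xs w] by (simp add: z)
    have step: "esize w (S c x a) \<le> esize w a + poly p (esize w z)" if "x \<in> set xs" for x a
      using p[of c x a] poly_nat_mono[of "esize w c + esize w x" "esize w z" p]
        esize_member[OF that, of w] by (simp add: z)
    have bound: "esize w (c, xs, a) + length xs * poly p (esize w z) \<le> ?N"
      using mult_le_mono1[OF len, of "poly p (esize w z)"] by (simp add: N_def flip: z)
    obtain n where n: "exec w W (encode z) (encode (c, [] :: 'x list, b)) n"
      "n \<le> (length xs + 1) * (5 + 2 * ?N + poly q ?N)"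
      "esize w b \<le> esize w a + length xs * poly p (esize w z)"
      using exec_fold_loop[where S = S, OF Q step bound] unfolding W_def b_def z by blast
    let ?k = "1 + (1 + esize w (c, [] :: 'x list, b)) + (1 + esize w ([] :: 'x list, b))"
    have "exec w (Seq (Prim Snd) (Prim Snd)) (encode (c, [] :: 'x list, b)) (encode b) ?k"
      using exec.Seq[OF exec.Prim exec.Prim, of w Snd Snd "encode (c, [] :: 'x list, b)"] by simp
    from exec.Seq[OF n(1) this]
    have ex: "exec w (Seq W (Seq (Prim Snd) (Prim Snd))) (encode z) (encode b) (1 + n + ?k)" .
    have "n \<le> (esize w z + 1) * (5 + 2 * ?N + poly q ?N)"
      using n(2) len by (meson add_le_mono1 le_trans mult_le_mono1)
    moreover have "esize w c + esize w b \<le> ?N"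
      using n(3) bound by simp
    ultimately have "1 + n + ?k + esize w b \<le> poly r (esize w z)"
      unfolding r_def by (simp add: poly_pcompose)
    then show ?thesis
      using ex by (auto simp: z b_def)
  qed
  then have "ptime w (\<lambda>z :: 'c \<times> 'x list \<times> 'a. fold (S (fst z)) (fst (snd z)) (snd (snd z)))"
    unfolding ptime_def by blast
  from ptime_comp[OF this, of "\<lambda>z. (c z, xs z, a z)"] show ?thesis
    using args by (simp add: ptime_Pair)
qed

lemma ptime_not [ptime_intros]:
  assumes "ptime w f"
  shows "ptime w (\<lambda>z. \<not> f z)"
proof -
  have "(\<lambda>z. \<not> f z) = (\<lambda>z. if f z then False else True)"
    by auto
  then show ?thesis
    by (simp only:) (intro ptime_intros assms)
qed

lemma ptime_or [ptime_intros]: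
  assumes "ptime w f" "ptime w g"
  shows "ptime w (\<lambda>z. f z \<or> g z)"
proof -
  have "(\<lambda>z. f z \<or> g z) = (\<lambda>z. if f z then True else g z)"
    by auto
  then show ?thesis
    by (simp only:) (intro ptime_intros assms)
qed

lemma ptime_and [ptime_intros]:
  assumes "ptime w f" "ptime w g"
  shows "ptime w (\<lambda>z. f z \<and> g z)"
proof -
  have "(\<lambda>z. f z \<and> g z) = (\<lambda>z. if f z then g z else False)"
    by auto
  then show ?thesis
    by (simp only:) (intro ptime_intros assms)
qed

lemma growsI:
  assumes "\<And>c x a. esize w (S c x a) \<le> esize w a + poly p (esize w c + esize w x)"
  shows "grows w S"
  using assms unfolding grows_def by blast

lemma grows_linear:
  assumes "\<And>c x a. esize w (S c x a) \<le> esize w a + esize w c + esize w x + k"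
  shows "grows w S"
  using assms by (intro growsI[where p = "[:k, 1:]"]) (simp add: algebra_simps)

lemma ptime_Bex:
  assumes P: "ptime w (\<lambda>p. P (fst p) (snd p))" and "ptime w c" "ptime w xs"
  shows "ptime w (\<lambda>z. \<exists>x\<in>set (xs z). P (c z) x)"
proof -
  have "fold (\<lambda>x r. if P (c z) x then True else r) ys r \<longleftrightarrow> r \<or> (\<exists>x\<in>set ys. P (c z) x)" for z ys r
    by (induction ys arbitrary: r) auto
  moreover have "ptime w (\<lambda>p. P (fst p) (fst (snd p)))"
    using ptime_comp[OF P, of "\<lambda>p. (fst p, fst (snd p))"] by (simp add: ptime_intros)
  then have "ptime w (\<lambda>p. if P (fst p) (fst (snd p)) then True else snd (snd p))"
    by (intro ptime_intros)
  then have "ptime w (\<lambda>z. fold (\<lambda>x r. if P (c z) x then True else r) (xs z) False)"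
    by (rule ptime_fold)
      (use assms(2,3) in \<open>auto intro!: ptime_False grows_linear[where k = "w 1"] simp: enc_bool_def\<close>)
  ultimately show ?thesis
    by simp
qed

lemma ptime_rev_map_filter:
  assumes P: "ptime w (\<lambda>p. P (fst p) (snd p))" and h: "ptime w (\<lambda>p. h (fst p) (snd p))"
    and "ptime w c" "ptime w xs"
  shows "ptime w (\<lambda>z. rev (map (h (c z)) (filter (P (c z)) (xs z))))"
proof -
  let ?S = "\<lambda>c x R. if P c x then h c x # R else R"
  obtain q where "\<And>p. esize w (h (fst p) (snd p)) \<le> poly q (esize w p)"
    using h by (rule ptimeE) (metis add_leD2)
  from this[of "(_, _)"] have q: "esize w (h c x) \<le> poly q (Suc (esize w c + esize w x))" for c x
    by simp
  have "grows w ?S"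
    by (rule growsI[where p = "1 + pcompose q [:1, 1:]"]) (use q in \<open>auto simp: poly_pcompose\<close>)
  moreover have "ptime w (\<lambda>p. P (fst p) (fst (snd p)))" "ptime w (\<lambda>p. h (fst p) (fst (snd p)))"
    using ptime_comp[OF P, of "\<lambda>p. (fst p, fst (snd p))"] ptime_comp[OF h, of "\<lambda>p. (fst p, fst (snd p))"]
    by (simp_all add: ptime_intros)
  then have "ptime w (\<lambda>p. ?S (fst p) (fst (snd p)) (snd (snd p)))"
    by (intro ptime_intros)
  ultimately have "ptime w (\<lambda>z. fold (?S (c z)) (xs z) [])"
    using assms(3,4) by (intro ptime_fold[where S = ?S and c = c] ptime_Nil)
  moreover have "fold (?S (c z)) ys R = rev (map (h (c z)) (filter (P (c z)) ys)) @ R" for z ys R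
    by (induction ys arbitrary: R) auto
  ultimately show ?thesis
    by simp
qed

lemma ptime_rev_map:
  assumes "ptime w (\<lambda>p. h (fst p) (snd p))" "ptime w c" "ptime w xs"
  shows "ptime w (\<lambda>z. rev (map (h (c z)) (xs z)))"
  using ptime_rev_map_filter[OF _ assms, of "\<lambda>_ _. True"] by (simp add: ptime_True)

lemma ptime_rev_filter:
  assumes "ptime w (\<lambda>p. P (fst p) (snd p))" "ptime w c" "ptime w xs"
  shows "ptime w (\<lambda>z. rev (filter (P (c z)) (xs z)))"
  using ptime_rev_map_filter[OF assms(1) _ assms(2,3), of "\<lambda>_ x. x"] by (simp add: ptime_intros)

lemma esize_rev_map_filter:
  assumes "\<And>x. esize w (h x) \<le> esize w x"
  shows "esize w (rev (map h (filter P xs))) \<le> esize w xs"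
proof -
  have "esize w (rev (map h (filter P xs)) @ R) + 1 \<le> esize w R + esize w xs" for R
  proof (induction xs arbitrary: R)
    case (Cons x xs)
    show ?case
      using Cons.IH[of R] Cons.IH[of "h x # R"] assms[of x] by auto
  qed simp
  from this[of "[]"] show ?thesis
    by simp
qed

lemma ptime_member [ptime_intros]:
  "ptime w f \<Longrightarrow> ptime w g \<Longrightarrow> ptime w (\<lambda>z. f z \<in> set (g z))"
  using ptime_Bex[where P = "(=)" and w = w and c = f and xs = g] by (simp add: ptime_intros)

lemma ptime_drop_length [ptime_intros]:
  fixes f :: "'a::encodable \<Rightarrow> 'b::encodable list" and g :: "'a \<Rightarrow> 'c::encodable list"
  assumes "ptime w f" "ptime w g"
  shows "ptime w (\<lambda>z. drop (length (f z)) (g z))"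
proof -
  have "fold (\<lambda>_. tl) ys xs = drop (length ys) xs" for xs :: "'c list" and ys :: "'b list"
    by (induction ys arbitrary: xs) (auto simp: drop_Suc)
  moreover have le: "esize w (tl xs) \<le> esize w xs" for xs :: "'c list"
    by (cases xs) auto
  have "ptime w (\<lambda>z. fold (\<lambda>_. tl) (f z) (g z))"
    by (intro ptime_fold[where S = "\<lambda>_ _. tl" and c = f] ptime_intros assms
      grows_linear[where k = 0] trans_le_add1 le)
  ultimately show ?thesis
    by simp
qed


section \<open>The algorithm\<close>

text \<open>An edge consists of a name, a tail and a head.\<close>

type_synonym edge = "nat \<times> nat \<times> nat"

definition reached :: "nat \<Rightarrow> edge list \<Rightarrow> nat \<Rightarrow> bool" where
  "reached s T v \<longleftrightarrow> v = s \<or> (\<exists>e\<in>set T. snd (snd e) = v)"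

lemma ptime_reached [ptime_intros]:
  assumes "ptime w f" "ptime w g" "ptime w h"
  shows "ptime w (\<lambda>z. reached (f z) (g z) (h z))"
  unfolding reached_def
  by (intro ptime_intros assms ptime_Bex[where P = "\<lambda>v e. snd (snd e) = v" and c = h])

text \<open>
  A search tree lists the tree edges, the most recently found one first, so that the path to a
  vertex can be read off in a single pass.
\<close>

definition extend_tree :: "nat \<Rightarrow> edge \<Rightarrow> edge list \<Rightarrow> edge list" where
  "extend_tree s e T =
     (if reached s T (fst (snd e)) \<and> \<not> reached s T (snd (snd e)) then e # T else T)"

definition search_tree :: "nat \<Rightarrow> edge list \<Rightarrow> edge list" where
  "search_tree s E = fold (\<lambda>_. fold (extend_tree s) E) E []"

definition backtrack_step :: "edge \<Rightarrow> nat \<times> nat list \<Rightarrow> nat \<times> nat list" where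
  "backtrack_step e p = (if snd (snd e) = fst p then (fst (snd e), fst e # snd p) else p)"

text \<open>The result is empty if \<open>t\<close> cannot be reached from \<open>s\<close>.\<close>

definition search :: "nat \<Rightarrow> nat \<Rightarrow> edge list \<Rightarrow> nat list" where
  "search s t E = snd (fold backtrack_step (search_tree s E) (t, []))"

lemma ptime_extend_tree [ptime_intros]:
  assumes "ptime w f" "ptime w g" "ptime w h"
  shows "ptime w (\<lambda>z. extend_tree (f z) (g z) (h z))"
  unfolding extend_tree_def by (intro ptime_intros assms)

lemma esize_extend_tree: "esize w (extend_tree s e T) \<le> esize w T + esize w e + 1"
  by (simp add: extend_tree_def)

lemma esize_extend_tree_all: "esize w (fold (extend_tree s) E T) \<le> esize w T + esize w E"
proof (induction E arbitrary: T)
  case (Cons e E)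
  show ?case
    using Cons.IH[of "extend_tree s e T"] esize_extend_tree[of w s e T] by simp
qed simp

lemma ptime_extend_tree_all [ptime_intros]:
  assumes "ptime w f" "ptime w g" "ptime w h"
  shows "ptime w (\<lambda>z. fold (extend_tree (f z)) (g z) (h z))"
proof -
  have "esize w (extend_tree c e T) \<le> esize w T + esize w c + esize w e + 1" for c e T
    using esize_extend_tree[of w c e T] by simp
  then have "grows w extend_tree"
    by (rule grows_linear)
  then show ?thesis
    by (intro ptime_fold[where S = extend_tree and c = f] ptime_intros assms)
qed

lemma ptime_search_tree [ptime_intros]:
  assumes "ptime w f" "ptime w g"
  shows "ptime w (\<lambda>z. search_tree (f z) (g z))"
proof -
  let ?S = "\<lambda>c (_ :: edge). fold (extend_tree (fst c)) (snd c)"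
  have "esize w (?S c e T) \<le> esize w T + esize w c + esize w e + 0" for c e T
    using esize_extend_tree_all[of w "fst c" "snd c" T] by (cases c) simp
  then have "grows w ?S"
    by (rule grows_linear)
  then have "ptime w (\<lambda>z. fold (?S (f z, g z)) (g z) [])"
    by (intro ptime_fold[where S = ?S and c = "\<lambda>z. (f z, g z)"] ptime_intros assms)
  then show ?thesis
    by (simp add: search_tree_def)
qed

lemma esize_search_tree: "esize w (search_tree s E) \<le> 1 + esize w E * esize w E"
proof -
  have "esize w (fold (\<lambda>_. fold (extend_tree s) E) E' T) \<le> esize w T + length E' * esize w E" for E' T
  proof (induction E' arbitrary: T)
    case (Cons e E')
    show ?case
      using Cons.IH[of "fold (extend_tree s) E T"] esize_extend_tree_all[of w s E T] by simp
  qed simp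
  from this[of E "[]"] have "esize w (search_tree s E) \<le> 1 + length E * esize w E"
    by (simp add: search_tree_def)
  also have "\<dots> \<le> 1 + esize w E * esize w E"
    by (intro add_left_mono mult_le_mono1 length_le_esize)
  finally show ?thesis .
qed

lemma ptime_search [ptime_intros]:
  assumes "ptime w f" "ptime w g" "ptime w h"
  shows "ptime w (\<lambda>z. search (f z) (g z) (h z))"
proof -
  let ?S = "\<lambda>_ :: nat. backtrack_step"
  have "grows w ?S"
    by (intro grows_linear[where k = 0]) (auto simp: backtrack_step_def)
  moreover have "ptime w (\<lambda>z :: nat \<times> edge \<times> nat \<times> nat list. backtrack_step (fst (snd z)) (snd (snd z)))"
    unfolding backtrack_step_def by (intro ptime_intros)
  ultimately show ?thesis
    unfolding search_def by (intro ptime_intros ptime_fold[where S = ?S and c = f] assms)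
qed

lemma esize_search: "esize w (search s t E) \<le> 2 + esize w E * esize w E"
proof -
  have "esize w (snd (fold backtrack_step T p)) \<le> esize w (snd p) + esize w T" for T p
  proof (induction T arbitrary: p)
    case (Cons e T)
    have "esize w (snd (backtrack_step e p)) \<le> esize w (snd p) + esize w e + 1"
      by (simp add: backtrack_step_def)
    then show ?case
      using Cons.IH[of "backtrack_step e p"] by simp
  qed simp
  from this[of "search_tree s E" "(t, [])"] show ?thesis
    using esize_search_tree[of w s E] by (simp add: search_def)
qed

definition residual :: "nat list \<Rightarrow> edge list \<Rightarrow> edge list" where
  "residual F E =
     rev (map (\<lambda>e. if fst e \<in> set F then (fst e, snd (snd e), fst (snd e)) else e) E)"

definition toggle :: "edge list \<Rightarrow> nat list \<Rightarrow> nat list \<Rightarrow> nat list" where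
  "toggle E F P = rev (map fst (filter (\<lambda>e. (fst e \<in> set F) = (fst e \<notin> set P)) E))"

definition augment :: "nat \<Rightarrow> nat \<Rightarrow> edge list \<Rightarrow> nat list \<Rightarrow> nat list" where
  "augment s t E F = toggle E F (search s t (residual F E))"

definition max_flow :: "nat \<Rightarrow> nat \<Rightarrow> edge list \<Rightarrow> nat list" where
  "max_flow s t E = fold (\<lambda>_. augment s t E) E []"

lemma ptime_residual [ptime_intros]:
  assumes "ptime w f" "ptime w g"
  shows "ptime w (\<lambda>z. residual (f z) (g z))"
  unfolding residual_def
  by (intro ptime_intros assms ptime_rev_map[where c = f and
    h = "\<lambda>F e. if fst e \<in> set F then (fst e, snd (snd e), fst (snd e)) else e"])

lemma ptime_toggle [ptime_intros]:
  assumes "ptime w f" "ptime w g" "ptime w h"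
  shows "ptime w (\<lambda>z. toggle (f z) (g z) (h z))"
proof -
  let ?P = "\<lambda>c (e :: edge). (fst e \<in> set (fst c)) = (fst e \<notin> set (snd c))"
  have "ptime w (\<lambda>z. rev (map ((\<lambda>_. fst) (g z, h z)) (filter (?P (g z, h z)) (f z))))"
    by (intro ptime_intros assms ptime_rev_map_filter[where P = ?P and h = "\<lambda>_. fst"
      and c = "\<lambda>z. (g z, h z)"])
  then show ?thesis
    by (simp add: toggle_def)
qed

lemma ptime_augment [ptime_intros]:
  assumes "ptime w s" "ptime w t" "ptime w E" "ptime w F"
  shows "ptime w (\<lambda>z. augment (s z) (t z) (E z) (F z))"
  unfolding augment_def by (intro ptime_intros assms)

lemma ptime_max_flow [ptime_intros]:
  assumes "ptime w f" "ptime w g" "ptime w h"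
  shows "ptime w (\<lambda>z. max_flow (f z) (g z) (h z))"
proof -
  let ?S = "\<lambda>c (_ :: edge). augment (fst c) (fst (snd c)) (snd (snd c))"
  have "esize w (?S c e F) \<le> esize w F + esize w c + esize w e + 0" for c e F
  proof -
    have "esize w (?S c e F) \<le> esize w (snd (snd c))"
      unfolding augment_def toggle_def by (rule esize_rev_map_filter) simp
    then show ?thesis
      by simp
  qed
  then have "grows w ?S"
    by (rule grows_linear)
  then have "ptime w (\<lambda>z. fold (?S (f z, g z, h z)) (h z) [])"
    by (intro ptime_fold[where S = ?S and c = "\<lambda>z. (f z, g z, h z)"] ptime_intros assms)
  then show ?thesis
    by (simp add: max_flow_def)
qed

definition unused :: "nat list list \<Rightarrow> edge list \<Rightarrow> edge list" where
  "unused Ps E = rev (filter (\<lambda>e. \<not> (\<exists>P\<in>set Ps. fst e \<in> set P)) E)"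

text \<open>The list \<open>K\<close> is a unary upper bound on the number of paths.\<close>

definition add_path :: "nat \<Rightarrow> nat \<Rightarrow> 'k::encodable list \<Rightarrow> edge list \<Rightarrow> nat list list \<Rightarrow> nat list list" where
  "add_path s t K E Ps =
     (if drop (length Ps) K = [] \<or> search s t (unused Ps E) = [] then Ps
      else search s t (unused Ps E) # Ps)"

definition add_paths :: "nat \<Rightarrow> nat \<Rightarrow> 'k::encodable list \<Rightarrow> edge list \<Rightarrow> nat list list \<Rightarrow> nat list list" where
  "add_paths s t K E Ps = fold (\<lambda>_. add_path s t K E) K Ps"

lemma ptime_unused [ptime_intros]:
  assumes "ptime w f" "ptime w g"
  shows "ptime w (\<lambda>z. unused (f z) (g z))"
proof -
  have "ptime w (\<lambda>p :: nat list list \<times> edge. \<not> (\<exists>P\<in>set (fst p). fst (snd p) \<in> set P))"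
    by (intro ptime_intros ptime_Bex[where P = "\<lambda>a P. a \<in> set P" and c = "\<lambda>p. fst (snd p)"])
  then show ?thesis
    unfolding unused_def
    by (intro assms ptime_rev_filter[where P = "\<lambda>Ps e. \<not> (\<exists>P\<in>set Ps. fst e \<in> set P)" and c = f])
qed

lemma ptime_add_path [ptime_intros]:
  assumes "ptime w s" "ptime w t" "ptime w K" "ptime w E" "ptime w Ps"
  shows "ptime w (\<lambda>z. add_path (s z) (t z) (K z) (E z) (Ps z))"
  unfolding add_path_def by (intro ptime_intros assms)

lemma esize_search_unused: "esize w (search s t (unused Ps E)) \<le> 2 + esize w E * esize w E"
proof -
  have "esize w (unused Ps E) \<le> esize w E"
    using esize_rev_map_filter[of w "\<lambda>e. e"] by (simp add: unused_def)
  from mult_le_mono[OF this this] show ?thesis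
    using esize_search[of w s t "unused Ps E"] by simp
qed

lemma esize_add_path: "esize w (add_path s t K E Ps) \<le> esize w Ps + (3 + esize w E * esize w E)"
  using esize_search_unused[of w s t Ps E] by (simp add: add_path_def)

lemma esize_add_paths:
  "esize w (add_paths s t K E Ps) \<le> esize w Ps + length K * (3 + esize w E * esize w E)"
proof -
  have "esize w (fold (\<lambda>_. add_path s t K E) L Ps) \<le> esize w Ps + length L * (3 + esize w E * esize w E)"
    for L :: "'b list" and Ps
  proof (induction L arbitrary: Ps)
    case (Cons x L)
    show ?case
      using Cons.IH[of "add_path s t K E Ps"] esize_add_path[of w s t K E Ps] by simp
  qed simp
  then show ?thesis
    by (simp add: add_paths_def)
qed

lemma ptime_add_paths [ptime_intros]:
  fixes K :: "'z::encodable \<Rightarrow> 'k::encodable list"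
  assumes "ptime w s" "ptime w t" "ptime w K" "ptime w E" "ptime w Ps"
  shows "ptime w (\<lambda>z. add_paths (s z) (t z) (K z) (E z) (Ps z))"
proof -
  let ?S = "\<lambda>c (_ :: 'k). add_path (fst c) (fst (snd c)) (fst (snd (snd c)) :: 'k list) (snd (snd (snd c)))"
  have "grows w ?S"
  proof (rule growsI)
    fix c :: "nat \<times> nat \<times> 'k list \<times> edge list" and x :: 'k and Ps
    let ?E = "snd (snd (snd c))"
    have "esize w ?E * esize w ?E \<le> (esize w c + esize w x) * (esize w c + esize w x)"
      by (rule mult_le_mono) auto
    then show "esize w (?S c x Ps) \<le> esize w Ps + poly [:3, 0, 1:] (esize w c + esize w x)"
      using esize_add_path[of w "fst c" "fst (snd c)" "fst (snd (snd c))" ?E Ps]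
      by (simp del: encode_prod)
  qed
  then have "ptime w (\<lambda>z. fold (?S (s z, t z, K z, E z)) (K z) (Ps z))"
    by (intro ptime_fold[where S = ?S and c = "\<lambda>z. (s z, t z, K z, E z)"] ptime_intros assms)
  then show ?thesis
    by (simp add: add_paths_def)
qed

text \<open>Name, tail, head, colour, capacity and flow.\<close>

type_synonym arc_data = "nat \<times> nat \<times> nat \<times> nat \<times> real \<times> real \<times> unit"

abbreviation (input) "arc_edge a \<equiv> (fst a, fst (snd a), fst (snd (snd a)))"
abbreviation (input) "arc_colour a \<equiv> fst (snd (snd (snd a)))"
abbreviation (input) "arc_flow a \<equiv> fst (snd (snd (snd (snd (snd a)))))"

definition edges :: "arc_data list \<Rightarrow> edge list" where
  "edges A = rev (map (\<lambda>a. arc_edge a) A)"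

definition coloured_edges :: "nat \<Rightarrow> arc_data list \<Rightarrow> edge list" where
  "coloured_edges c A = rev (map (\<lambda>a. arc_edge a) (filter (\<lambda>a. arc_colour a = c) A))"

definition flow_edges :: "nat \<Rightarrow> nat \<Rightarrow> edge list \<Rightarrow> edge list" where
  "flow_edges s t E = rev (filter (\<lambda>e. fst e \<in> set (max_flow s t E)) E)"

definition mono_paths :: "nat \<Rightarrow> nat \<Rightarrow> 'k::encodable list \<Rightarrow> arc_data list \<Rightarrow> nat list list" where
  "mono_paths s t K A =
     fold (\<lambda>a. add_paths s t K (flow_edges s t (coloured_edges (arc_colour a) A))) A []"

definition add_cycle :: "edge list \<Rightarrow> edge \<Rightarrow> nat list list \<Rightarrow> nat list list" where
  "add_cycle E e Cs =
     (if \<exists>C\<in>set Cs. fst e \<in> set C then Cs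
      else (fst e # search (snd (snd e)) (fst (snd e)) (unused Cs E)) # Cs)"

definition cycles :: "edge list \<Rightarrow> nat list list" where
  "cycles E = fold (add_cycle E) E []"

definition out_edges :: "nat \<Rightarrow> edge list \<Rightarrow> edge list" where
  "out_edges v E = rev (filter (\<lambda>e. fst (snd e) = v) E)"

definition in_edges :: "nat \<Rightarrow> edge list \<Rightarrow> edge list" where
  "in_edges v E = rev (filter (\<lambda>e. snd (snd e) = v) E)"

definition weigh :: "real \<Rightarrow> nat list list \<Rightarrow> (nat list \<times> real) list" where
  "weigh l Ps = rev (map (\<lambda>P. (P, l)) Ps)"

definition flow_constant :: "arc_data list \<Rightarrow> real" where
  "flow_constant A = fold (\<lambda>a _. arc_flow a) A 0"

definition support :: "arc_data list \<Rightarrow> arc_data list" where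
  "support A = rev (filter (\<lambda>a. arc_flow a \<noteq> 0) A)"

definition flow_paths :: "nat \<Rightarrow> nat \<Rightarrow> arc_data list \<Rightarrow> nat list list" where
  "flow_paths s t A =
     (let K = drop (length (in_edges s (edges A))) (out_edges s (edges A))
      in add_paths s t K (edges A) (mono_paths s t K A))"

definition decompose :: "nat \<Rightarrow> nat \<Rightarrow> arc_data list \<Rightarrow> nat decomposition option" where
  "decompose s t A =
     (if drop (length (out_edges s (edges A))) (in_edges s (edges A)) = [] then
        Some (weigh (flow_constant A) (flow_paths s t A),
          weigh (flow_constant A) (cycles (unused (flow_paths s t A) (edges A))))
      else None)"

lemma ptime_edges [ptime_intros]: "ptime w f \<Longrightarrow> ptime w (\<lambda>z. edges (f z))"
  unfolding edges_def
  by (rule ptime_rev_map[where h = "\<lambda>_ a. arc_edge a" and c = f]) (intro ptime_intros | assumption)+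

lemma ptime_coloured_edges [ptime_intros]:
  "ptime w f \<Longrightarrow> ptime w g \<Longrightarrow> ptime w (\<lambda>z. coloured_edges (f z) (g z))"
  unfolding coloured_edges_def
  by (rule ptime_rev_map_filter[where P = "\<lambda>c a. arc_colour a = c" and h = "\<lambda>_ a. arc_edge a" and c = f])
    (intro ptime_intros | assumption)+

lemma ptime_flow_edges [ptime_intros]:
  assumes "ptime w f" "ptime w g" "ptime w h"
  shows "ptime w (\<lambda>z. flow_edges (f z) (g z) (h z))"
  unfolding flow_edges_def
  by (rule ptime_rev_filter[where P = "\<lambda>F e. fst e \<in> set F"]) (intro ptime_intros assms)+

lemma esize_flow_edges: "esize w (flow_edges s t (coloured_edges c A)) \<le> esize w A"
proof -
  have "esize w (flow_edges s t E) \<le> esize w E" for E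
    using esize_rev_map_filter[of w "\<lambda>e. e"] by (simp add: flow_edges_def)
  also have "esize w (coloured_edges c A) \<le> esize w A"
    unfolding coloured_edges_def by (rule esize_rev_map_filter) simp
  finally show ?thesis .
qed

lemma ptime_mono_paths [ptime_intros]:
  fixes K :: "'z::encodable \<Rightarrow> 'k::encodable list"
  assumes "ptime w s" "ptime w t" "ptime w K" "ptime w A"
  shows "ptime w (\<lambda>z. mono_paths (s z) (t z) (K z) (A z))"
proof -
  let ?S = "\<lambda>c (a :: arc_data). add_paths (fst c) (fst (snd c)) (fst (snd (snd c)) :: 'k list)
    (flow_edges (fst c) (fst (snd c)) (coloured_edges (arc_colour a) (snd (snd (snd c)))))"
  have "grows w ?S"
  proof (rule growsI)
    fix c :: "nat \<times> nat \<times> 'k list \<times> arc_data list" and x :: arc_data and Ps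
    let ?K = "fst (snd (snd c))"
    let ?E = "flow_edges (fst c) (fst (snd c)) (coloured_edges (arc_colour x) (snd (snd (snd c))))"
    let ?n = "esize w c + esize w x"
    have "esize w ?E \<le> ?n"
      using esize_flow_edges[of w "fst c" "fst (snd c)" "arc_colour x" "snd (snd (snd c))"] by simp
    moreover have "length ?K \<le> ?n"
      using length_le_esize[of ?K w] by simp
    ultimately have "length ?K * (3 + esize w ?E * esize w ?E) \<le> ?n * (3 + ?n * ?n)"
      by (intro mult_le_mono add_left_mono)
    then show "esize w (?S c x Ps) \<le> esize w Ps + poly [:0, 3, 0, 1:] ?n"
      using esize_add_paths[of w "fst c" "fst (snd c)" ?K ?E Ps]
      by (simp del: encode_prod)
  qed
  then have "ptime w (\<lambda>z. fold (?S (s z, t z, K z, A z)) (A z) [])"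
    by (intro ptime_fold[where S = ?S and c = "\<lambda>z. (s z, t z, K z, A z)"] ptime_intros assms)
  then show ?thesis
    by (simp add: mono_paths_def)
qed

lemma ptime_cycles [ptime_intros]:
  assumes "ptime w f"
  shows "ptime w (\<lambda>z. cycles (f z))"
proof -
  have "ptime w (\<lambda>p. add_cycle (fst p) (fst (snd p)) (snd (snd p)))"
    unfolding add_cycle_def
    by (intro ptime_intros ptime_Bex[where P = "\<lambda>a C. a \<in> set C" and c = "\<lambda>p. fst (fst (snd p))"])
  moreover have "grows w add_cycle"
  proof (rule growsI)
    fix E :: "edge list" and x :: edge and Cs
    let ?n = "esize w E + esize w x"
    have "esize w E * esize w E \<le> ?n * ?n"
      by (rule mult_le_mono) auto
    moreover have "esize w (fst x) \<le> ?n"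
      by simp
    ultimately show "esize w (add_cycle E x Cs) \<le> esize w Cs + poly [:4, 1, 1:] ?n"
      using esize_search_unused[of w "snd (snd x)" "fst (snd x)" Cs E]
      by (simp add: add_cycle_def del: encode_prod)
  qed
  ultimately show ?thesis
    unfolding cycles_def by (rule ptime_fold) (intro ptime_intros assms)+
qed

lemma ptime_out_edges [ptime_intros]: "ptime w f \<Longrightarrow> ptime w g \<Longrightarrow> ptime w (\<lambda>z. out_edges (f z) (g z))"
  unfolding out_edges_def
  by (rule ptime_rev_filter[where P = "\<lambda>v e. fst (snd e) = v"]) (intro ptime_intros | assumption)+

lemma ptime_in_edges [ptime_intros]: "ptime w f \<Longrightarrow> ptime w g \<Longrightarrow> ptime w (\<lambda>z. in_edges (f z) (g z))"
  unfolding in_edges_def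
  by (rule ptime_rev_filter[where P = "\<lambda>v e. snd (snd e) = v"]) (intro ptime_intros | assumption)+

lemma ptime_weigh [ptime_intros]: "ptime w f \<Longrightarrow> ptime w g \<Longrightarrow> ptime w (\<lambda>z. weigh (f z) (g z))"
  unfolding weigh_def
  by (rule ptime_rev_map[where h = "\<lambda>l P. (P, l)" and c = f]) (intro ptime_intros | assumption)+

lemma ptime_flow_constant [ptime_intros]: "ptime w f \<Longrightarrow> ptime w (\<lambda>z. flow_constant (f z))"
  unfolding flow_constant_def
  by (rule ptime_fold[where S = "\<lambda>_ a _. arc_flow a" and c = f])
    (intro ptime_intros grows_linear[where k = 0] | simp)+

lemma ptime_support [ptime_intros]: "ptime w f \<Longrightarrow> ptime w (\<lambda>z. support (f z))"
  unfolding support_def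
  by (rule ptime_rev_filter[where P = "\<lambda>_ a. arc_flow a \<noteq> 0" and c = f])
    (intro ptime_intros | assumption)+

lemma ptime_decompose:
  assumes "ptime w s" "ptime w t" "ptime w A"
  shows "ptime w (\<lambda>z. decompose (s z) (t z) (A z))"
  unfolding decompose_def flow_paths_def Let_def by (intro ptime_intros assms)


section \<open>Net flow\<close>

definition net :: "('v, 'a) pre_digraph \<Rightarrow> ('a \<Rightarrow> real) \<Rightarrow> 'v \<Rightarrow> real" where
  "net G y v = (\<Sum>a\<in>arcs G. y a * (of_bool (tail G a = v) - of_bool (head G a = v)))"

definition char_flow :: "'a set \<Rightarrow> 'a \<Rightarrow> real" where
  "char_flow F a = of_bool (a \<in> F)"

lemma net_add: "net G (\<lambda>a. y a + z a) v = net G y v + net G z v"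
  by (simp add: net_def distrib_right sum.distrib)

lemma net_scale: "net G (\<lambda>a. r * y a) v = r * net G y v"
  by (simp add: net_def sum_distrib_left mult.assoc)

lemma net_zero: "net G (\<lambda>a. 0) v = 0"
  by (simp add: net_def)

lemma net_cong: "(\<And>a. a \<in> arcs G \<Longrightarrow> y a = z a) \<Longrightarrow> net G y v = net G z v"
  by (simp add: net_def)

lemma net_sum_list: "net G (\<lambda>a. \<Sum>p\<leftarrow>ps. f p a) v = (\<Sum>p\<leftarrow>ps. net G (f p) v)"
  by (induction ps) (simp_all add: net_zero net_add)

lemma net_char_flow_union:
  assumes "A \<inter> B = {}"
  shows "net G (char_flow (A \<union> B)) v = net G (char_flow A) v + net G (char_flow B) v"
  unfolding net_add[symmetric] using assms by (intro net_cong) (auto simp: char_flow_def)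

lemma net_char_flow_diff:
  assumes "B \<subseteq> A"
  shows "net G (char_flow (A - B)) v = net G (char_flow A) v - net G (char_flow B) v"
proof -
  have "net G (char_flow (A - B \<union> B)) v = net G (char_flow (A - B)) v + net G (char_flow B) v"
    by (rule net_char_flow_union) auto
  moreover have "A - B \<union> B = A"
    using assms by auto
  ultimately show ?thesis
    by simp
qed

lemma net_char_flow_empty: "net G (char_flow {}) v = 0"
  by (simp add: net_def char_flow_def)

lemma const_flow_eq: "const_flow P r = (\<lambda>a. r * char_flow (set P) a)"
  by (auto simp: const_flow_def char_flow_def)

context fin_digraph
begin

lemma net_eq: "net G y v = sum y (out_arcs G v) - sum y (in_arcs G v)"
proof -
  have "net G y v = (\<Sum>a\<in>arcs G. (if tail G a = v then y a else 0) - (if head G a = v then y a else 0))"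
    unfolding net_def by (intro sum.cong) auto
  also have "\<dots> = sum y (out_arcs G v) - sum y (in_arcs G v)"
    by (simp add: sum_subtractf sum.inter_filter[symmetric] out_arcs_def in_arcs_def)
  finally show ?thesis .
qed

lemma sum_net:
  assumes "finite S"
  shows "(\<Sum>v\<in>S. net G y v) = (\<Sum>a\<in>arcs G. y a * (of_bool (tail G a \<in> S) - of_bool (head G a \<in> S)))"
proof -
  have ind: "(\<Sum>v\<in>S. of_bool (u = v)) = (of_bool (u \<in> S) :: real)" for u
    using assms by (simp add: of_bool_def)
  show ?thesis
    unfolding net_def sum.swap[of _ _ S]
    by (simp add: sum_distrib_left[symmetric] sum_subtractf ind)
qed

lemma sum_net_cut:
  assumes "\<And>v. v \<in> verts G - {s, t} \<Longrightarrow> net G y v = 0" "s \<in> S" "t \<notin> S" "S \<subseteq> verts G"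
  shows "net G y s = (\<Sum>a\<in>arcs G. y a * (of_bool (tail G a \<in> S) - of_bool (head G a \<in> S)))"
proof -
  have fin: "finite S"
    using assms(4) by (rule finite_subset) simp
  have "(\<Sum>v\<in>S. net G y v) = net G y s + (\<Sum>v\<in>S - {s}. net G y v)"
    using fin assms(2) by (simp add: sum.remove)
  also have "(\<Sum>v\<in>S - {s}. net G y v) = 0"
    using assms by (intro sum.neutral ballI assms(1)) auto
  finally show ?thesis
    by (simp add: sum_net[OF fin])
qed

lemma net_sink_zero:
  assumes "\<And>v. v \<in> verts G - {t} \<Longrightarrow> net G y v = 0" "t \<in> verts G"
  shows "net G y t = 0"
proof -
  have "(\<Sum>v\<in>verts G. net G y v) = net G y t + (\<Sum>v\<in>verts G - {t}. net G y v)"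
    using assms(2) by (simp add: sum.remove)
  moreover have "(\<Sum>v\<in>verts G - {t}. net G y v) = 0"
    by (intro sum.neutral ballI assms(1))
  moreover have "(\<Sum>v\<in>verts G. net G y v) = 0"
    by (simp add: sum_net)
  ultimately show ?thesis
    by simp
qed

lemma net_closed_le_0:
  assumes "\<And>v. v \<in> verts G - {s, t} \<Longrightarrow> net G (char_flow F) v = 0" "s \<in> S" "t \<notin> S" "S \<subseteq> verts G"
    and "\<And>a. a \<in> F \<Longrightarrow> tail G a \<in> S \<Longrightarrow> head G a \<in> S"
  shows "net G (char_flow F) s \<le> 0"
proof -
  have "net G (char_flow F) s = (\<Sum>a\<in>arcs G. char_flow F a * (of_bool (tail G a \<in> S) - of_bool (head G a \<in> S)))"
    using assms(1-4) by (rule sum_net_cut)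
  also have "\<dots> \<le> 0"
    using assms(5) by (intro sum_nonpos) (auto simp: char_flow_def)
  finally show ?thesis .
qed

lemma net_cas:
  assumes "cas u p v" "set p \<subseteq> arcs G" "distinct p"
  shows "net G (char_flow (set p)) x = of_bool (u = x) - of_bool (v = x)"
  using assms
proof (induction p arbitrary: u)
  case Nil
  then show ?case by (simp add: net_char_flow_empty)
next
  case (Cons e p)
  have "net G (char_flow {e}) x = of_bool (tail G e = x) - of_bool (head G e = x)"
  proof -
    have "net G (char_flow {e}) x =
        (\<Sum>a\<in>arcs G. if a = e then of_bool (tail G e = x) - of_bool (head G e = x) else 0)"
      unfolding net_def by (intro sum.cong) (auto simp: char_flow_def)
    then show ?thesis
      using Cons.prems(2) by simp
  qed
  moreover have "net G (char_flow (insert e (set p))) x = net G (char_flow {e}) x + net G (char_flow (set p)) x"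
    using Cons.prems(3) net_char_flow_union[of "{e}" "set p"] by simp
  ultimately show ?case
    using Cons.IH[of "head G e"] Cons.prems by auto
qed

lemma net_apath:
  assumes "apath u p v"
  shows "net G (char_flow (set p)) x = of_bool (u = x) - of_bool (v = x)"
  using assms unfolding apath_def by (intro net_cas) (auto intro: distinct_verts_imp_distinct)

lemma net_cycle:
  assumes "cycle p"
  shows "net G (char_flow (set p)) x = 0"
proof -
  obtain u where "awalk u p u" "distinct p"
    using assms unfolding cycle_conv by blast
  then have "net G (char_flow (set p)) x = of_bool (u = x) - of_bool (u = x)"
    by (intro net_cas) auto
  then show ?thesis
    by simp
qed

lemma net_paths:
  assumes "\<forall>P\<in>set Ps. apath s P t" "distinct (concat Ps)"
  shows "net G (char_flow (set (concat Ps))) v = real (length Ps) * (of_bool (s = v) - of_bool (t = v))"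
  using assms
proof (induction Ps)
  case Nil
  then show ?case by (simp add: net_char_flow_empty)
next
  case (Cons P Ps)
  then show ?case
    using net_char_flow_union[of "set P" "set (concat Ps)" G v] net_apath[of s P t v]
    by (simp add: algebra_simps)
qed

lemma net_cycles:
  assumes "\<forall>C\<in>set Cs. cycle C" "distinct (concat Cs)"
  shows "net G (char_flow (set (concat Cs))) v = 0"
  using assms
proof (induction Cs)
  case Nil
  then show ?case by (simp add: net_char_flow_empty)
next
  case (Cons C Cs)
  then show ?case
    using net_char_flow_union[of "set C" "set (concat Cs)" G v] net_cycle[of C v] by simp
qed

end


section \<open>Correctness of the search\<close>

definition edge_of :: "(nat, nat) pre_digraph \<Rightarrow> nat \<Rightarrow> edge" where
  "edge_of G a = (a, tail G a, head G a)"

lemma edge_of_simps [simp]: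
  "fst (edge_of G a) = a" "fst (snd (edge_of G a)) = tail G a" "snd (snd (edge_of G a)) = head G a"
  by (simp_all add: edge_of_def)

primrec is_tree :: "nat \<Rightarrow> edge list \<Rightarrow> edge list \<Rightarrow> bool" where
  "is_tree s E [] \<longleftrightarrow> True"
| "is_tree s E (e # T) \<longleftrightarrow> is_tree s E T \<and> e \<in> set E \<and>
     reached s T (fst (snd e)) \<and> \<not> reached s T (snd (snd e))"

lemma is_tree_subset: "is_tree s E T \<Longrightarrow> set T \<subseteq> set E"
  by (induction T) auto

lemma is_tree_distinct: "is_tree s E T \<Longrightarrow> distinct T"
  by (induction T) (auto simp: reached_def)

lemma is_tree_extend_tree: "is_tree s E T \<Longrightarrow> e \<in> set E \<Longrightarrow> is_tree s E (extend_tree s e T)"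
  by (simp add: extend_tree_def)

lemma is_tree_extend_tree_all:
  "is_tree s E T \<Longrightarrow> set E' \<subseteq> set E \<Longrightarrow> is_tree s E (fold (extend_tree s) E' T)"
  by (induction E' arbitrary: T) (auto intro: is_tree_extend_tree)

lemma is_tree_search_tree: "is_tree s E (search_tree s E)"
proof -
  have "is_tree s E (fold (\<lambda>_. fold (extend_tree s) E) E' T)" if "is_tree s E T" for E' :: "edge list" and T
    using that by (induction E' arbitrary: T) (auto intro: is_tree_extend_tree_all)
  then show ?thesis
    by (simp add: search_tree_def)
qed

lemma extend_tree_cases: "extend_tree s e T = T \<or> length (extend_tree s e T) = Suc (length T)"
  by (simp add: extend_tree_def)

lemma length_extend_tree_all: "length T \<le> length (fold (extend_tree s) E T)"
proof (induction E arbitrary: T)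
  case (Cons e E)
  show ?case
    using Cons.IH[of "extend_tree s e T"] extend_tree_cases[of s e T] by auto
qed simp

lemma extend_tree_all_stable:
  assumes "length (fold (extend_tree s) E T) = length T" "e \<in> set E"
  shows "extend_tree s e T = T"
  using assms
proof (induction E arbitrary: T)
  case (Cons d E)
  have "extend_tree s d T = T"
    using extend_tree_cases[of s d T] length_extend_tree_all[of "extend_tree s d T" s E] Cons.prems(1)
    by auto
  then show ?case
    using Cons by auto
qed simp

lemma extend_tree_all_id:
  "(\<And>e. e \<in> set E \<Longrightarrow> extend_tree s e T = T) \<Longrightarrow> fold (extend_tree s) E T = T"
  by (induction E) auto

lemma search_tree_stable:
  assumes "e \<in> set E"
  shows "extend_tree s e (search_tree s E) = search_tree s E"
proof -
  let ?f = "fold (extend_tree s) E"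
  have rounds: "(\<forall>e\<in>set E. extend_tree s e (fold (\<lambda>_. ?f) E' T) = fold (\<lambda>_. ?f) E' T)
      \<or> length T + length E' \<le> length (fold (\<lambda>_. ?f) E' T)" for E' :: "edge list" and T
  proof (induction E' arbitrary: T)
    case (Cons d E')
    show ?case
    proof (cases "length (?f T) = length T")
      case True
      from extend_tree_all_stable[OF this] have st: "\<And>e. e \<in> set E \<Longrightarrow> extend_tree s e T = T" .
      then have "?f T = T"
        by (rule extend_tree_all_id)
      then have "fold (\<lambda>_. ?f) L T = T" for L :: "edge list"
        by (induction L) auto
      then show ?thesis
        using st \<open>?f T = T\<close> by (simp only: fold.simps o_apply simp_thms) simp
    next
      case False
      then have "length (?f T) \<ge> Suc (length T)"
        using length_extend_tree_all[of T s E] by simp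
      then show ?thesis
        using Cons.IH[of "?f T"] by auto
    qed
  qed simp
  let ?T = "search_tree s E"
  have T: "set ?T \<subseteq> set E" "distinct ?T"
    using is_tree_search_tree is_tree_subset is_tree_distinct by blast+
  show ?thesis
  proof (cases "length E \<le> length ?T")
    case True
    then have "card (set E) \<le> card (set ?T)"
      using card_length[of E] distinct_card[OF T(2)] by simp
    then have "set ?T = set E"
      using T(1) card_seteq by blast
    then show ?thesis
      using assms by (auto simp: extend_tree_def reached_def)
  next
    case False
    then show ?thesis
      using rounds[of E "[]"] assms by (simp add: search_tree_def)
  qed
qed

lemma backtrack_unreached:
  "\<not> reached s T v \<Longrightarrow> fold backtrack_step T (v, q) = (v, q)"
  by (induction T) (auto simp: reached_def backtrack_step_def)

lemma backtrack_reached: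
  assumes "wf_digraph G" "s \<in> verts G" "set E \<subseteq> edge_of G ` B" "B \<subseteq> arcs G"
    and "is_tree s E T" "reached s T v"
  shows "\<exists>p. fold backtrack_step T (v, q) = (s, p @ q) \<and> pre_digraph.apath G s p v \<and> set p \<subseteq> B \<and>
    (\<forall>x\<in>set (pre_digraph.awalk_verts G s p). reached s T x)"
  using assms(5,6)
proof (induction T arbitrary: v q)
  interpret wf_digraph G by (rule assms(1))
  case Nil
  then show ?case
    using assms(2) by (auto simp: reached_def apath_Nil_iff)
next
  interpret wf_digraph G by (rule assms(1))
  case (Cons e T)
  show ?case
  proof (cases "snd (snd e) = v")
    case True
    obtain a where a: "e = edge_of G a" "a \<in> B"
      using Cons.prems(1) assms(3) by auto
    obtain p where p: "fold backtrack_step T (tail G a, a # q) = (s, p @ a # q)"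
      "apath s p (tail G a)" "set p \<subseteq> B" "\<forall>x\<in>set (awalk_verts s p). reached s T x"
      using Cons.IH[of "tail G a" "a # q"] Cons.prems(1) a by auto
    have v: "v = head G a" "\<not> reached s T v"
      using True Cons.prems(1) a by auto
    have aw: "awalk s (p @ [a]) v"
      using p(2) a(2) assms(4) v by (auto simp: apath_def awalk_simps)
    have verts: "awalk_verts s (p @ [a]) = awalk_verts s p @ [v]"
      using awalk_verts_append[OF aw] p(2) v by (auto simp: apath_def)
    have "apath s (p @ [a]) v"
      using aw p(2,4) v by (auto simp: apath_def verts)
    moreover have "\<forall>x\<in>set (awalk_verts s (p @ [a])). reached s (e # T) x"
      using p(4) True by (auto simp: verts reached_def)
    moreover have "fold backtrack_step (e # T) (v, q) = (s, (p @ [a]) @ q)"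
      using True p(1) a by (simp add: backtrack_step_def)
    ultimately show ?thesis
      using p(3) a(2) by (intro exI[of _ "p @ [a]"]) auto
  next
    case False
    then have "reached s T v"
      using Cons.prems(2) by (auto simp: reached_def)
    then obtain p where "fold backtrack_step T (v, q) = (s, p @ q)"
      "apath s p v" "set p \<subseteq> B" "\<forall>x\<in>set (awalk_verts s p). reached s T x"
      using Cons.IH[of v q] Cons.prems(1) by auto
    moreover have "backtrack_step e (v, q) = (v, q)"
      using False by (simp add: backtrack_step_def)
    ultimately show ?thesis
      by (intro exI[of _ p]) (auto simp: reached_def)
  qed
qed

lemma search_correct:
  assumes "wf_digraph G" "s \<in> verts G" "set as \<subseteq> arcs G"
  obtains S where "s \<in> S" "S \<subseteq> verts G"
    "\<And>a. a \<in> set as \<Longrightarrow> tail G a \<in> S \<Longrightarrow> head G a \<in> S"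
    "t \<in> S \<Longrightarrow> pre_digraph.apath G s (search s t (map (edge_of G) as)) t \<and>
       set (search s t (map (edge_of G) as)) \<subseteq> set as"
    "t \<notin> S \<Longrightarrow> search s t (map (edge_of G) as) = []"
proof
  interpret wf_digraph G by (rule assms(1))
  let ?E = "map (edge_of G) as"
  let ?T = "search_tree s ?E"
  let ?S = "{v. reached s ?T v}"
  have tree: "is_tree s ?E ?T"
    by (rule is_tree_search_tree)
  show "s \<in> ?S"
    by (simp add: reached_def)
  show "?S \<subseteq> verts G"
    using assms(2,3) is_tree_subset[OF tree] by (fastforce simp: reached_def)
  show "head G a \<in> ?S" if "a \<in> set as" "tail G a \<in> ?S" for a
    using search_tree_stable[of "edge_of G a" ?E s] that
    by (auto simp: extend_tree_def split: if_splits)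
  show "apath s (search s t ?E) t \<and> set (search s t ?E) \<subseteq> set as" if "t \<in> ?S"
    using backtrack_reached[OF assms(1,2) _ assms(3) tree, of t "[]"] that
    by (auto simp: search_def)
  show "search s t ?E = []" if "t \<notin> ?S"
    using backtrack_unreached[of s ?T t "[]"] that by (simp add: search_def)
qed


section \<open>Maximum flows\<close>

definition flip :: "('v, 'a) pre_digraph \<Rightarrow> 'a set \<Rightarrow> ('v, 'a) pre_digraph" where
  "flip G F = G\<lparr>tail := \<lambda>a. if a \<in> F then head G a else tail G a,
     head := \<lambda>a. if a \<in> F then tail G a else head G a\<rparr>"

lemma flip_simps [simp]:
  "verts (flip G F) = verts G" "arcs (flip G F) = arcs G"
  "tail (flip G F) a = (if a \<in> F then head G a else tail G a)"
  "head (flip G F) a = (if a \<in> F then tail G a else head G a)"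
  by (simp_all add: flip_def)

lemma fin_digraph_flip: "fin_digraph G \<Longrightarrow> fin_digraph (flip G F)"
proof -
  assume "fin_digraph G"
  then interpret fin_digraph G .
  show ?thesis
    by standard auto
qed

lemma residual_edge_of:
  "residual F (map (edge_of G) as) = map (edge_of (flip G (set F))) (rev as)"
  by (simp add: residual_def rev_map edge_of_def)

lemma set_toggle: "set (toggle E F P) = {a \<in> fst ` set E. a \<in> set F \<longleftrightarrow> a \<notin> set P}"
  by (auto simp: toggle_def)

lemma net_flip: "net G (\<lambda>a. (if a \<in> F then - 1 else 1) * y a) v = net (flip G F) y v"
  unfolding net_def by (intro sum.cong) auto

lemma net_augment:
  assumes "fin_digraph G" "pre_digraph.apath (flip G F) s P t" "F \<subseteq> B" "set P \<subseteq> B"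
  shows "net G (char_flow {a \<in> B. a \<in> F \<longleftrightarrow> a \<notin> set P}) v =
    net G (char_flow F) v + of_bool (s = v) - of_bool (t = v)"
proof -
  have "net G (char_flow {a \<in> B. a \<in> F \<longleftrightarrow> a \<notin> set P}) v =
    net G (\<lambda>a. char_flow F a + (if a \<in> F then - 1 else 1) * char_flow (set P) a) v"
    using assms(3,4) by (intro net_cong) (auto simp: char_flow_def)
  also have "\<dots> = net G (char_flow F) v + net (flip G F) (char_flow (set P)) v"
    by (simp only: net_add net_flip)
  also have "net (flip G F) (char_flow (set P)) v = of_bool (s = v) - of_bool (t = v)"
    by (rule fin_digraph.net_apath[OF fin_digraph_flip[OF assms(1)] assms(2)])
  finally show ?thesis
    by simp
qed

locale flow_graph = fin_digraph G for G :: "(nat, nat) pre_digraph" +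
  fixes s t :: nat
  assumes s_verts [simp]: "s \<in> verts G" and t_verts [simp]: "t \<in> verts G"
begin

definition conserved :: "(nat \<Rightarrow> real) \<Rightarrow> bool" where
  "conserved y \<longleftrightarrow> (\<forall>v\<in>verts G - {s, t}. net G y v = 0)"

definition unit_flow :: "nat set \<Rightarrow> (nat \<Rightarrow> real) \<Rightarrow> bool" where
  "unit_flow B y \<longleftrightarrow> conserved y \<and> (\<forall>a\<in>arcs G. 0 \<le> y a \<and> y a \<le> char_flow B a)"

definition max_unit_flow :: "nat set \<Rightarrow> nat set \<Rightarrow> bool" where
  "max_unit_flow B F \<longleftrightarrow> F \<subseteq> B \<and> conserved (char_flow F) \<and>
     (\<forall>y. unit_flow B y \<longrightarrow> net G y s \<le> net G (char_flow F) s)"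

lemma unit_flow_cut:
  assumes "unit_flow B y" "conserved (char_flow F)" "F \<subseteq> B" "s \<in> S" "t \<notin> S" "S \<subseteq> verts G"
    and closed: "\<And>a. a \<in> B \<Longrightarrow> tail (flip G F) a \<in> S \<Longrightarrow> head (flip G F) a \<in> S"
  shows "net G y s \<le> net G (char_flow F) s"
proof -
  let ?d = "\<lambda>a. of_bool (tail G a \<in> S) - of_bool (head G a \<in> S) :: real"
  have "net G y s = (\<Sum>a\<in>arcs G. y a * ?d a)"
    using assms(1) by (intro sum_net_cut[OF _ assms(4-6)]) (auto simp: unit_flow_def conserved_def)
  also have "\<dots> \<le> (\<Sum>a\<in>arcs G. char_flow F a * ?d a)"
  proof (rule sum_mono)
    fix a
    assume "a \<in> arcs G"
    then have y: "0 \<le> y a" "y a \<le> char_flow B a"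
      using assms(1) by (auto simp: unit_flow_def)
    show "y a * ?d a \<le> char_flow F a * ?d a"
    proof (cases "a \<in> B")
      case True
      then show ?thesis
        using y closed[of a] by (cases "a \<in> F") (auto simp: char_flow_def)
    next
      case False
      then show ?thesis
        using y assms(3) by (auto simp: char_flow_def)
    qed
  qed
  also have "\<dots> = net G (char_flow F) s"
    using assms(2) by (intro sum_net_cut[OF _ assms(4-6), symmetric]) (auto simp: conserved_def)
  finally show ?thesis .
qed

lemma augment_correct:
  assumes "s \<noteq> t" "set as \<subseteq> arcs G" "set F \<subseteq> set as" "conserved (char_flow (set F))"
  defines "F' \<equiv> set (augment s t (map (edge_of G) as) F)"
  shows "F' \<subseteq> set as \<and> conserved (char_flow F') \<and>
    (F' = set F \<and> max_unit_flow (set as) (set F) \<or>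
     net G (char_flow F') s = net G (char_flow (set F)) s + 1)"
proof -
  let ?H = "flip G (set F)"
  interpret H: fin_digraph ?H
    by (rule fin_digraph_flip) (rule fin_digraph_axioms)
  define P where "P = search s t (map (edge_of ?H) (rev as))"
  have F': "F' = {a \<in> set as. a \<in> set F \<longleftrightarrow> a \<notin> set P}"
    by (auto simp: F'_def augment_def set_toggle residual_edge_of P_def image_image)
  obtain S where S: "s \<in> S" "S \<subseteq> verts G"
    "\<And>a. a \<in> set as \<Longrightarrow> tail ?H a \<in> S \<Longrightarrow> head ?H a \<in> S"
    "t \<in> S \<Longrightarrow> H.apath s P t \<and> set P \<subseteq> set as" "t \<notin> S \<Longrightarrow> P = []"
    unfolding P_def
    by (rule search_correct[OF H.wf_digraph_axioms, of s "rev as" t]) (use assms(2) in auto)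
  show ?thesis
  proof (cases "t \<in> S")
    case True
    then have P: "H.apath s P t" "set P \<subseteq> set as"
      using S(4) by auto
    note net = net_augment[OF fin_digraph_axioms P(1) assms(3) P(2), folded F']
    show ?thesis
      using assms(1,4) by (auto simp: F' conserved_def net[unfolded F'])
  next
    case False
    then have "F' = set F"
      using S(5) assms(3) by (auto simp: F')
    moreover have "max_unit_flow (set as) (set F)"
      unfolding max_unit_flow_def
      using unit_flow_cut[OF _ assms(4,3) S(1) False S(2,3)] assms(3,4) by blast
    ultimately show ?thesis
      using assms(3,4) by simp
  qed
qed

lemma max_flow_correct:
  assumes "s \<noteq> t" "set as \<subseteq> arcs G"
  shows "max_unit_flow (set as) (set (max_flow s t (map (edge_of G) as)))"
proof -
  let ?f = "augment s t (map (edge_of G) as)"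
  have rounds: "set (fold (\<lambda>_. ?f) L F) \<subseteq> set as \<and> conserved (char_flow (set (fold (\<lambda>_. ?f) L F))) \<and>
      net G (char_flow (set F)) s \<le> net G (char_flow (set (fold (\<lambda>_. ?f) L F))) s \<and>
      (max_unit_flow (set as) (set (fold (\<lambda>_. ?f) L F)) \<or>
       net G (char_flow (set F)) s + length L \<le> net G (char_flow (set (fold (\<lambda>_. ?f) L F))) s)"
    if "set F \<subseteq> set as" "conserved (char_flow (set F))" for L :: "edge list" and F
    using that
  proof (induction L arbitrary: F)
    case (Cons e L)
    have step: "set (?f F) \<subseteq> set as" "conserved (char_flow (set (?f F)))"
      "set (?f F) = set F \<and> max_unit_flow (set as) (set F) \<or>
       net G (char_flow (set (?f F))) s = net G (char_flow (set F)) s + 1"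
      using augment_correct[OF assms Cons.prems] by auto
    note IH = Cons.IH[OF step(1,2)]
    from step(3) show ?case
    proof
      assume opt: "set (?f F) = set F \<and> max_unit_flow (set as) (set F)"
      then have "max_unit_flow (set as) (set (fold (\<lambda>_. ?f) L (?f F)))"
        using IH unfolding max_unit_flow_def by (auto intro: order_trans)
      then show ?thesis
        using IH opt by simp
    next
      assume "net G (char_flow (set (?f F))) s = net G (char_flow (set F)) s + 1"
      then show ?thesis
        using IH by auto
    qed
  qed simp
  let ?F = "set (max_flow s t (map (edge_of G) as))"
  have "conserved (char_flow (set []))"
    by (simp add: conserved_def net_char_flow_empty)
  from rounds[OF _ this, of "map (edge_of G) as"]
  have F: "?F \<subseteq> set as" "conserved (char_flow ?F)"
    "max_unit_flow (set as) ?F \<or> length as \<le> net G (char_flow ?F) s"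
    by (simp_all add: max_flow_def net_char_flow_empty)
  have "net G y s \<le> length as" if "unit_flow (set as) y" for y
  proof -
    have "net G y s \<le> (\<Sum>a\<in>arcs G. char_flow (set as) a)"
      unfolding net_def using that
      by (intro sum_mono) (fastforce simp: unit_flow_def of_bool_def)
    also have "\<dots> = card (set as)"
      using assms(2) by (simp add: char_flow_def Int_absorb1)
    also have "\<dots> \<le> length as"
      using card_length by simp
    finally show ?thesis
      by simp
  qed
  then show ?thesis
    using F unfolding max_unit_flow_def by (meson order_trans)
qed


section \<open>Path systems\<close>

definition path_system :: "nat list list \<Rightarrow> bool" where
  "path_system Ps \<longleftrightarrow> (\<forall>P\<in>set Ps. apath s P t) \<and> distinct (concat Ps)"

lemma net_path_system:
  "path_system Ps \<Longrightarrow> net G (char_flow (set (concat Ps))) v = real (length Ps) * (of_bool (s = v) - of_bool (t = v))"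
  unfolding path_system_def by (intro net_paths) auto

definition separated :: "nat set \<Rightarrow> bool" where
  "separated B \<longleftrightarrow> (\<exists>S. s \<in> S \<and> t \<notin> S \<and> S \<subseteq> verts G \<and> (\<forall>a\<in>B. tail G a \<in> S \<longrightarrow> head G a \<in> S))"

lemma separated_net:
  assumes "separated B" "conserved (char_flow B)"
  shows "net G (char_flow B) s \<le> 0"
  using assms unfolding separated_def conserved_def by (auto intro: net_closed_le_0)

lemma unused_edge_of:
  "unused Ps (map (edge_of G) as) = map (edge_of G) (rev (filter (\<lambda>a. a \<notin> set (concat Ps)) as))"
  by (simp add: unused_def rev_map filter_map o_def)

lemma add_path_correct:
  assumes "s \<noteq> t" "set as \<subseteq> arcs G" "path_system Ps" "length Ps \<le> length K"
  defines "Ps' \<equiv> add_path s t K (map (edge_of G) as) Ps"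
  shows "Ps' = Ps \<and> (length Ps = length K \<or> separated (set as - set (concat Ps))) \<or>
    (\<exists>P. Ps' = P # Ps \<and> path_system (P # Ps) \<and> set P \<subseteq> set as \<and> length (P # Ps) \<le> length K)"
proof (cases "length Ps = length K")
  case True
  then show ?thesis
    by (simp add: Ps'_def add_path_def)
next
  case False
  let ?as = "rev (filter (\<lambda>a. a \<notin> set (concat Ps)) as)"
  let ?P = "search s t (map (edge_of G) ?as)"
  have Ps': "Ps' = (if ?P = [] then Ps else ?P # Ps)"
    using False assms(4) by (simp add: Ps'_def add_path_def unused_edge_of del: set_concat)
  obtain S where S: "s \<in> S" "S \<subseteq> verts G"
    "\<And>a. a \<in> set ?as \<Longrightarrow> tail G a \<in> S \<Longrightarrow> head G a \<in> S"
    "t \<in> S \<Longrightarrow> apath s ?P t \<and> set ?P \<subseteq> set ?as" "t \<notin> S \<Longrightarrow> ?P = []"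
    by (rule search_correct[OF wf_digraph_axioms s_verts, of ?as t]) (use assms(2) in auto)
  show ?thesis
  proof (cases "t \<in> S")
    case True
    then have P: "apath s ?P t" "set ?P \<subseteq> set as - set (concat Ps)"
      using S(4) by auto
    have "?P \<noteq> []"
      using P(1) assms(1) by (auto simp: apath_Nil_iff)
    moreover have "distinct ?P"
      using P(1) by (auto simp: apath_def intro: distinct_verts_imp_distinct)
    ultimately show ?thesis
      using P assms(3,4) False by (auto simp: Ps' path_system_def)
  next
    case False
    moreover from this have "separated (set as - set (concat Ps))"
      using S(1-3) unfolding separated_def by (intro exI[of _ S]) auto
    ultimately show ?thesis
      using S(5) by (simp add: Ps')
  qed
qed

lemma add_paths_correct:
  assumes "s \<noteq> t" "set as \<subseteq> arcs G" "path_system Ps" "length Ps \<le> length K"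
  obtains Qs where "add_paths s t K (map (edge_of G) as) Ps = Qs @ Ps" "path_system (Qs @ Ps)"
    "set (concat Qs) \<subseteq> set as" "length (Qs @ Ps) \<le> length K"
    "length (Qs @ Ps) = length K \<or> separated (set as - set (concat (Qs @ Ps)))"
proof -
  let ?f = "add_path s t K (map (edge_of G) as)"
  let ?stuck = "\<lambda>Ps. length Ps = length K \<or> separated (set as - set (concat Ps))"
  have "\<exists>Qs. fold (\<lambda>_. ?f) L Ps = Qs @ Ps \<and> path_system (Qs @ Ps) \<and> set (concat Qs) \<subseteq> set as \<and>
      length (Qs @ Ps) \<le> length K \<and> (?stuck (Qs @ Ps) \<or> length L \<le> length Qs)"
    if "path_system Ps" "length Ps \<le> length K" for L :: "'b list" and Ps
    using that
  proof (induction L arbitrary: Ps)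
    case (Cons x L)
    consider "?f Ps = Ps" "?stuck Ps" | P where "?f Ps = P # Ps" "path_system (P # Ps)"
        "set P \<subseteq> set as" "length (P # Ps) \<le> length K"
      using add_path_correct[OF assms(1,2) Cons.prems] by blast
    then show ?case
    proof cases
      case 1
      have "fold (\<lambda>_. ?f) L Ps = Ps" for L :: "'b list"
        using 1(1) by (induction L) auto
      then show ?thesis
        using 1 Cons.prems by (intro exI[of _ "[]"]) auto
    next
      case P: 2
      obtain Qs where "fold (\<lambda>_. ?f) L (P # Ps) = Qs @ P # Ps" "path_system (Qs @ P # Ps)"
        "set (concat Qs) \<subseteq> set as" "length (Qs @ P # Ps) \<le> length K"
        "?stuck (Qs @ P # Ps) \<or> length L \<le> length Qs"
        using Cons.IH[OF P(2,4)] by blast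
      then show ?thesis
        using P(1,3) by (intro exI[of _ "Qs @ [P]"]) auto
    qed
  qed auto
  from this[OF assms(3,4), of K] show ?thesis
    using that assms(4) unfolding add_paths_def by force
qed

lemma conserved_diff:
  assumes "conserved (char_flow A)" "conserved (char_flow B)" "B \<subseteq> A"
  shows "conserved (char_flow (A - B))"
  using assms by (simp add: conserved_def net_char_flow_diff)

lemma conserved_path_system: "path_system Ps \<Longrightarrow> conserved (char_flow (set (concat Ps)))"
  by (auto simp: conserved_def net_path_system simp del: set_concat)

lemma add_paths_separated:
  assumes "path_system Qs" "set (concat Qs) \<subseteq> B" "conserved (char_flow B)"
    "separated (B - set (concat Qs))" "s \<noteq> t"
  shows "net G (char_flow B) s \<le> length Qs"
proof -
  have "net G (char_flow (B - set (concat Qs))) s \<le> 0"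
    using assms by (intro separated_net conserved_diff conserved_path_system)
  then show ?thesis
    using assms(2,5) net_path_system[OF assms(1), of s] by (simp add: net_char_flow_diff)
qed

end


section \<open>Cycles\<close>

lemma (in fin_digraph) circulation_closed:
  assumes "\<And>v. v \<in> verts G \<Longrightarrow> net G (char_flow R) v = 0" "a \<in> R" "R \<subseteq> arcs G"
    "head G a \<in> S" "S \<subseteq> verts G" "\<And>b. b \<in> R \<Longrightarrow> tail G b \<in> S \<Longrightarrow> head G b \<in> S"
  shows "tail G a \<in> S"
proof (rule ccontr)
  assume a: "tail G a \<notin> S"
  let ?f = "\<lambda>b. char_flow R b * (of_bool (tail G b \<in> S) - of_bool (head G b \<in> S))"
  have fin: "finite S"
    using assms(5) by (rule finite_subset) simp
  have "(\<Sum>v\<in>S. net G (char_flow R) v) = 0"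
    using assms(1,5) by (intro sum.neutral) auto
  moreover have "sum ?f (arcs G) = ?f a + sum ?f (arcs G - {a})"
    using assms(2,3) by (intro sum.remove) auto
  moreover have "sum ?f (arcs G - {a}) \<le> 0"
    using assms(6) by (intro sum_nonpos) (auto simp: char_flow_def)
  ultimately show False
    using a assms(2,4) by (simp add: sum_net[OF fin] char_flow_def)
qed

lemma add_cycle_correct:
  fixes G :: "(nat, nat) pre_digraph"
  assumes "fin_digraph G" "set rs \<subseteq> arcs G" "a \<in> set rs"
    and circ: "\<And>v. v \<in> verts G \<Longrightarrow> net G (char_flow (set rs)) v = 0"
    and Cs: "\<forall>C\<in>set Cs. pre_digraph.cycle G C" "distinct (concat Cs)" "set (concat Cs) \<subseteq> set rs"
  defines "Cs' \<equiv> add_cycle (map (edge_of G) rs) (edge_of G a) Cs"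
  shows "(\<forall>C\<in>set Cs'. pre_digraph.cycle G C) \<and> distinct (concat Cs') \<and>
    set (concat Cs) \<union> {a} \<subseteq> set (concat Cs') \<and> set (concat Cs') \<subseteq> set rs"
proof (cases "a \<in> set (concat Cs)")
  case True
  then have "Cs' = Cs"
    by (auto simp: Cs'_def add_cycle_def)
  then show ?thesis
    using Cs True by simp
next
  case False
  interpret fin_digraph G by (rule assms(1))
  let ?R = "set rs - set (concat Cs)"
  define as where "as = rev (filter (\<lambda>a. a \<notin> set (concat Cs)) rs)"
  have as: "set as = ?R"
    by (auto simp: as_def)
  define P where "P = search (head G a) (tail G a) (map (edge_of G) as)"
  have "unused Cs (map (edge_of G) rs) = map (edge_of G) as"
    by (simp add: unused_def rev_map filter_map o_def as_def)
  then have Cs': "Cs' = (a # P) # Cs"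
    using False by (auto simp: Cs'_def add_cycle_def P_def)
  have a: "a \<in> arcs G" "a \<in> ?R"
    using assms(2,3) False by auto
  obtain S where S: "head G a \<in> S" "S \<subseteq> verts G"
    "\<And>b. b \<in> ?R \<Longrightarrow> tail G b \<in> S \<Longrightarrow> head G b \<in> S"
    "tail G a \<in> S \<Longrightarrow> apath (head G a) P (tail G a) \<and> set P \<subseteq> ?R"
    unfolding P_def as[symmetric]
    by (rule search_correct[OF wf_digraph_axioms, of "head G a" as "tail G a"])
      (use a(1) assms(2) as in auto)
  have "net G (char_flow ?R) v = 0" if "v \<in> verts G" for v
    using circ[OF that] net_cycles[OF Cs(1,2)] Cs(3) by (simp add: net_char_flow_diff)
  then have "tail G a \<in> S"
    using circulation_closed[of ?R a S] a S(1-3) assms(2) by blast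
  then have P: "apath (head G a) P (tail G a)" "set P \<subseteq> ?R"
    using S(4) by auto
  have aw: "awalk (tail G a) (a # P) (tail G a)" "distinct (tl (awalk_verts (tail G a) (a # P)))"
    using P(1) a(1) by (auto simp: apath_def awalk_Cons_iff)
  then have "cycle (a # P)"
    by (auto simp: cycle_def)
  moreover have "distinct (a # P)"
    using aw by (rule distinct_tl_verts_imp_distinct)
  ultimately show ?thesis
    using Cs P(2) a(2) False by (auto simp: Cs')
qed

lemma cycles_correct:
  fixes G :: "(nat, nat) pre_digraph"
  assumes "fin_digraph G" "set rs \<subseteq> arcs G"
    and circ: "\<And>v. v \<in> verts G \<Longrightarrow> net G (char_flow (set rs)) v = 0"
  defines "Cs \<equiv> cycles (map (edge_of G) rs)"
  shows "\<forall>C\<in>set Cs. pre_digraph.cycle G C" "distinct (concat Cs)" "set (concat Cs) = set rs"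
proof -
  let ?f = "add_cycle (map (edge_of G) rs)"
  have "(\<forall>C\<in>set (fold ?f (map (edge_of G) as) Cs). pre_digraph.cycle G C) \<and>
      distinct (concat (fold ?f (map (edge_of G) as) Cs)) \<and>
      set (concat Cs) \<union> set as \<subseteq> set (concat (fold ?f (map (edge_of G) as) Cs)) \<and>
      set (concat (fold ?f (map (edge_of G) as) Cs)) \<subseteq> set rs"
    if "set as \<subseteq> set rs" "\<forall>C\<in>set Cs. pre_digraph.cycle G C" "distinct (concat Cs)"
      "set (concat Cs) \<subseteq> set rs" for as Cs
    using that
  proof (induction as arbitrary: Cs)
    case (Cons a as)
    let ?Cs = "?f (edge_of G a) Cs"
    have "(\<forall>C\<in>set ?Cs. pre_digraph.cycle G C) \<and> distinct (concat ?Cs) \<and>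
        set (concat Cs) \<union> {a} \<subseteq> set (concat ?Cs) \<and> set (concat ?Cs) \<subseteq> set rs"
      using Cons.prems by (intro add_cycle_correct assms(1,2) circ) auto
    then show ?case
      using Cons.IH[of ?Cs] Cons.prems(1) by (simp del: set_concat) blast
  qed auto
  from this[of rs "[]"] show "\<forall>C\<in>set Cs. pre_digraph.cycle G C" "distinct (concat Cs)" "set (concat Cs) = set rs"
    unfolding Cs_def cycles_def by (auto simp del: set_concat)
qed


section \<open>Correctness of the algorithm\<close>

definition arc_data_of :: "cfd_instance \<Rightarrow> nat \<Rightarrow> arc_data" where
  "arc_data_of I a =
     (a, tail (graph I) a, head (graph I) a, colour I a, capacity I a, flow I a, ())"

lemma arc_colour_arc_data_of [simp]: "arc_colour (arc_data_of I a) = colour I a"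
  by (simp add: arc_data_of_def)

lemma edges_arc_data_of: "edges (map (arc_data_of I) bs) = map (edge_of (graph I)) (rev bs)"
  by (simp add: edges_def rev_map arc_data_of_def edge_of_def)

lemma coloured_edges_arc_data_of:
  "coloured_edges k (map (arc_data_of I) bs) =
     map (edge_of (graph I)) (rev (filter (\<lambda>a. colour I a = k) bs))"
  by (simp add: coloured_edges_def rev_map arc_data_of_def edge_of_def filter_map o_def)

lemma flow_edges_edge_of:
  "flow_edges s t (map (edge_of G) as) =
     map (edge_of G) (rev (filter (\<lambda>a. a \<in> set (max_flow s t (map (edge_of G) as))) as))"
  by (simp add: flow_edges_def rev_map filter_map o_def)

lemma support_arc_data_of:
  "support (map (arc_data_of I) as) = map (arc_data_of I) (rev (filter (\<lambda>a. flow I a \<noteq> 0) as))"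
  by (simp add: support_def rev_map filter_map o_def arc_data_of_def)

lemma flow_constant_arc_data_of:
  assumes "\<And>a. a \<in> set bs \<Longrightarrow> flow I a = l" "bs \<noteq> []"
  shows "flow_constant (map (arc_data_of I) bs) = l"
proof -
  have "fold (\<lambda>a _. arc_flow a) (map (arc_data_of I) bs) r = l" for r
    using assms
  proof (induction bs arbitrary: r)
    case (Cons b bs)
    then show ?case
      by (cases "bs = []") (auto simp: arc_data_of_def)
  qed simp
  then show ?thesis
    by (simp add: flow_constant_def)
qed

lemma sum_list_const_flow:
  assumes "distinct (concat Ps)"
  shows "(\<Sum>(P, r)\<leftarrow>weigh l Ps. const_flow P r a) = l * of_bool (a \<in> set (concat Ps))"
proof -
  have "(\<Sum>P\<leftarrow>Ps. const_flow P l a) = l * of_bool (a \<in> set (concat Ps))"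
    using assms by (induction Ps) (auto simp: const_flow_def)
  then show ?thesis
    by (simp add: weigh_def o_def sum_list_rev flip: rev_map)
qed

lemma sum_list_weigh: "(\<Sum>(P, r)\<leftarrow>weigh l Ps. f P) = (\<Sum>P\<leftarrow>Ps. f P)" for f :: "_ \<Rightarrow> nat"
  by (simp add: weigh_def o_def sum_list_rev flip: rev_map)

lemma sum_list_filter_le:
  fixes f :: "'a \<Rightarrow> real"
  assumes "\<And>p. p \<in> set ps \<Longrightarrow> 0 \<le> f p"
  shows "(\<Sum>p\<leftarrow>filter Q ps. f p) \<le> (\<Sum>p\<leftarrow>ps. f p)"
  using assms
proof (induction ps)
  case (Cons p ps)
  then have "(\<Sum>p\<leftarrow>filter Q ps. f p) \<le> (\<Sum>p\<leftarrow>ps. f p)" "0 \<le> f p"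
    by simp_all
  then show ?case
    by simp
qed simp

lemma sum_list_sum_filter:
  fixes f :: "'a \<Rightarrow> real"
  assumes "finite C"
  shows "(\<Sum>p\<leftarrow>ps. f p * (2 - (\<Sum>k\<in>C. of_bool (Q k p)))) =
    2 * (\<Sum>p\<leftarrow>ps. f p) - (\<Sum>k\<in>C. \<Sum>p\<leftarrow>filter (Q k) ps. f p)"
proof (induction ps)
  case (Cons p ps)
  have "(\<Sum>k\<in>C. \<Sum>p\<leftarrow>filter (Q k) (p # ps). f p) =
      (\<Sum>k\<in>C. f p * of_bool (Q k p) + (\<Sum>p\<leftarrow>filter (Q k) ps. f p))"
    by (intro sum.cong) auto
  also have "\<dots> = f p * (\<Sum>k\<in>C. of_bool (Q k p)) + (\<Sum>k\<in>C. \<Sum>p\<leftarrow>filter (Q k) ps. f p)"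
    by (simp only: sum.distrib sum_distrib_left)
  finally show ?case
    using Cons by (simp add: algebra_simps)
qed simp

lemma is_decompositionD:
  assumes "is_decomposition G s t x d"
  shows "\<And>p. p \<in> set (fst d) \<Longrightarrow> pre_digraph.apath G s (fst p) t \<and> 0 < snd p"
    "\<And>p. p \<in> set (snd d) \<Longrightarrow> pre_digraph.cycle G (fst p) \<and> 0 < snd p"
    "\<And>a. a \<in> arcs G \<Longrightarrow> x a = (\<Sum>p\<leftarrow>fst d. const_flow (fst p) (snd p) a) +
       (\<Sum>p\<leftarrow>snd d. const_flow (fst p) (snd p) a)"
  using assms unfolding is_decomposition_def case_prod_unfold by blast+

lemma (in fin_digraph) net_const_flow:
  assumes "apath u P v"
  shows "net G (const_flow P r) z = r * (of_bool (u = z) - of_bool (v = z))"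
  unfolding const_flow_eq net_scale net_apath[OF assms] ..

lemma (in fin_digraph) net_decomposition:
  assumes "is_decomposition G s t x d"
  shows "net G x v = (\<Sum>p\<leftarrow>fst d. snd p) * (of_bool (s = v) - of_bool (t = v))"
proof -
  note D = is_decompositionD[OF assms]
  have "net G x v = net G (\<lambda>a. (\<Sum>p\<leftarrow>fst d. const_flow (fst p) (snd p) a) +
       (\<Sum>p\<leftarrow>snd d. const_flow (fst p) (snd p) a)) v"
    by (rule net_cong) (rule D(3))
  also have "\<dots> = (\<Sum>p\<leftarrow>fst d. net G (const_flow (fst p) (snd p)) v) +
      (\<Sum>p\<leftarrow>snd d. net G (const_flow (fst p) (snd p)) v)"
    by (simp only: net_add net_sum_list)
  also have "(\<Sum>p\<leftarrow>snd d. net G (const_flow (fst p) (snd p)) v) = (\<Sum>p\<leftarrow>snd d. 0)"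
    using D(2) by (intro arg_cong[where f = sum_list] map_cong refl)
      (auto simp: const_flow_eq net_scale net_cycle)
  also have "(\<Sum>p\<leftarrow>fst d. net G (const_flow (fst p) (snd p)) v) =
      (\<Sum>p\<leftarrow>fst d. snd p * (of_bool (s = v) - of_bool (t = v)))"
    using D(1) by (intro arg_cong[where f = sum_list] map_cong refl)
      (simp add: net_const_flow[where u = s and v = t])
  finally show ?thesis
    by (simp add: sum_list_mult_const)
qed

locale uniform_cfd =
  fixes I :: cfd_instance and l :: real
  assumes inst: "I \<in> cfd_instances" and bichromatic: "bichromatic I"
    and l_pos: "0 < l" and uniform: "uniform_flow (graph I) l (flow I)"

sublocale uniform_cfd \<subseteq> flow_graph "graph I" "source I" "sink I"
  using inst by (intro flow_graph.intro flow_graph_axioms.intro) (auto simp: cfd_instances_def)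

context uniform_cfd
begin

abbreviation "G \<equiv> graph I"
abbreviation "s \<equiv> source I"
abbreviation "t \<equiv> sink I"
abbreviation "x \<equiv> flow I"

definition bs :: "nat list" where
  "bs = rev (filter (\<lambda>a. x a \<noteq> 0) (sorted_list_of_set (arcs G)))"

abbreviation "A \<equiv> map (arc_data_of I) bs"

lemma set_bs: "set bs = {a \<in> arcs G. x a = l}"
  using uniform l_pos by (auto simp: bs_def uniform_flow_def)

lemma bs_arcs: "set bs \<subseteq> arcs G"
  by (auto simp: set_bs)

lemma distinct_bs: "distinct bs"
  by (simp add: bs_def)

lemma flow_eq: "a \<in> arcs G \<Longrightarrow> x a = l * char_flow (set bs) a"
  using uniform by (auto simp: set_bs char_flow_def uniform_flow_def)

lemma net_flow: "net G x v = l * net G (char_flow (set bs)) v"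
  unfolding net_scale[symmetric] by (rule net_cong) (rule flow_eq)

lemma conserved_bs: "conserved (char_flow (set bs))"
proof -
  have "net G x v = 0" if "v \<in> verts G - {s, t}" for v
    using inst that by (auto simp: cfd_instances_def is_st_flow_def net_eq)
  then show ?thesis
    using l_pos by (auto simp: conserved_def net_flow)
qed

lemma net_bs:
  "net G (char_flow (set bs)) v =
     real (length (out_edges v (edges A))) - real (length (in_edges v (edges A)))"
proof -
  have "length (out_edges v (edges A)) = card ({a. tail G a = v} \<inter> set bs)"
    by (simp add: out_edges_def edges_arc_data_of filter_map o_def distinct_length_filter distinct_bs)
  moreover have "length (in_edges v (edges A)) = card ({a. head G a = v} \<inter> set bs)"
    by (simp add: in_edges_def edges_arc_data_of filter_map o_def distinct_length_filter distinct_bs)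
  moreover have "sum (char_flow (set bs)) (out_arcs G v) = card (out_arcs G v \<inter> set bs)"
    by (simp add: char_flow_def finite_out_arcs)
  moreover have "out_arcs G v \<inter> set bs = {a. tail G a = v} \<inter> set bs"
    using bs_arcs by auto
  moreover have "sum (char_flow (set bs)) (in_arcs G v) = card (in_arcs G v \<inter> set bs)"
    by (simp add: char_flow_def finite_in_arcs)
  moreover have "in_arcs G v \<inter> set bs = {a. head G a = v} \<inter> set bs"
    using bs_arcs by auto
  ultimately show ?thesis
    by (simp add: net_eq)
qed

definition coloured_arcs :: "nat \<Rightarrow> nat list" where
  "coloured_arcs k = rev (filter (\<lambda>a. colour I a = k) bs)"

definition coloured_flow :: "nat \<Rightarrow> nat set" where
  "coloured_flow k = set (max_flow s t (map (edge_of G) (coloured_arcs k)))"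

lemma set_coloured_arcs: "set (coloured_arcs k) = {a \<in> set bs. colour I a = k}"
  by (auto simp: coloured_arcs_def)

lemma max_unit_flow_coloured:
  "s \<noteq> t \<Longrightarrow> max_unit_flow {a \<in> set bs. colour I a = k} (coloured_flow k)"
  unfolding coloured_flow_def set_coloured_arcs[symmetric]
  using bs_arcs by (intro max_flow_correct) (auto simp: coloured_arcs_def)

text \<open>\<open>C\<close> is the set of the colours that have already been treated.\<close>

definition mono_system :: "nat \<Rightarrow> nat set \<Rightarrow> nat list list \<Rightarrow> bool" where
  "mono_system k C Ps \<longleftrightarrow> path_system Ps \<and> length Ps \<le> k \<and>
     (\<forall>P\<in>set Ps. \<exists>c\<in>C. colour I ` set P \<subseteq> {c}) \<and> set (concat Ps) \<subseteq> set bs \<and>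
     (length Ps = k \<or> (\<Sum>c\<in>C. net G (char_flow (coloured_flow c)) s) \<le> length Ps)"

lemma mono_system_step:
  assumes "s \<noteq> t" "finite C" "mono_system (length K) C Ps"
  shows "mono_system (length K) (insert c C)
    (add_paths s t K (flow_edges s t (coloured_edges c A)) Ps)"
proof -
  let ?F = "coloured_flow c"
  note F = max_unit_flow_coloured[OF assms(1), of c, unfolded max_unit_flow_def]
  define as where "as = rev (filter (\<lambda>a. a \<in> ?F) (coloured_arcs c))"
  have as: "set as = ?F"
    using F by (auto simp: as_def set_coloured_arcs)
  have E: "flow_edges s t (coloured_edges c A) = map (edge_of G) as"
    by (simp add: coloured_edges_arc_data_of flow_edges_edge_of as_def coloured_flow_def
        coloured_arcs_def[symmetric])
  note Ps = assms(3)[unfolded mono_system_def]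
  obtain Qs where Qs: "add_paths s t K (map (edge_of G) as) Ps = Qs @ Ps" "path_system (Qs @ Ps)"
    "set (concat Qs) \<subseteq> set as" "length (Qs @ Ps) \<le> length K"
    "length (Qs @ Ps) = length K \<or> separated (set as - set (concat (Qs @ Ps)))"
    by (rule add_paths_correct[of as Ps K]) (use assms(1) Ps F bs_arcs as in auto)
  have mono: "\<exists>k\<in>insert c C. colour I ` set P \<subseteq> {k}" if "P \<in> set (Qs @ Ps)" for P
  proof (cases "P \<in> set Ps")
    case True
    then show ?thesis
      using Ps by blast
  next
    case False
    then have "set P \<subseteq> ?F"
      using that Qs(3) as by auto
    then show ?thesis
      using F by (intro bexI[of _ c]) auto
  qed
  have "length (Qs @ Ps) = length K \<or>
    (\<Sum>c\<in>insert c C. net G (char_flow (coloured_flow c)) s) \<le> length (Qs @ Ps)"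
  proof (cases "length (Qs @ Ps) = length K \<or> c \<in> C")
    case True
    then show ?thesis
      using Ps Qs(4) by (auto simp: insert_absorb)
  next
    case False
    have "set (concat Ps) \<inter> ?F = {}"
    proof (rule ccontr)
      assume "set (concat Ps) \<inter> ?F \<noteq> {}"
      then obtain P a where "P \<in> set Ps" "a \<in> set P" "a \<in> ?F"
        by auto
      moreover from this obtain k where "k \<in> C" "colour I ` set P \<subseteq> {k}"
        using Ps by blast
      ultimately have "c \<in> C"
        using F by auto
      then show False
        using False by simp
    qed
    then have "set as - set (concat (Qs @ Ps)) = ?F - set (concat Qs)"
      using as by auto
    then have "separated (?F - set (concat Qs))"
      using Qs(5) False by simp
    moreover have "path_system Qs"
      using Qs(2) by (auto simp: path_system_def)
    ultimately have "net G (char_flow ?F) s \<le> length Qs"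
      using Qs(3) as F assms(1) by (intro add_paths_separated) auto
    moreover have "(\<Sum>c\<in>C. net G (char_flow (coloured_flow c)) s) \<le> length Ps"
      using Ps False Qs(4) by auto
    ultimately show ?thesis
      using False assms(2) by simp
  qed
  then show ?thesis
    unfolding E Qs(1) mono_system_def
    using Qs(2-4) mono as F Ps by auto
qed

lemma mono_paths_correct:
  assumes "s \<noteq> t"
  shows "mono_system (length K) (colour I ` set bs) (mono_paths s t K A)"
proof -
  have "mono_system (length K) (C \<union> colour I ` set as)
      (fold (\<lambda>a. add_paths s t K (flow_edges s t (coloured_edges (arc_colour a) A)))
        (map (arc_data_of I) as) Ps)"
    if "mono_system (length K) C Ps" "finite C" for as C Ps
    using that
  proof (induction as arbitrary: C Ps)
    case (Cons a as)
    from Cons.IH[OF mono_system_step[OF assms Cons.prems(2,1), of "colour I a"]] Cons.prems(2)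
    show ?case
      by simp
  qed simp
  from this[of "{}" "[]" bs] show ?thesis
    by (simp add: mono_paths_def mono_system_def path_system_def)
qed

definition path_bound :: "edge list" where
  "path_bound = drop (length (in_edges s (edges A))) (out_edges s (edges A))"

lemma flow_paths_eq:
  "flow_paths s t A = add_paths s t path_bound (edges A) (mono_paths s t path_bound A)"
  by (simp add: flow_paths_def path_bound_def Let_def)

lemma add_paths_Nil: "add_paths s t [] E Ps = Ps"
  by (simp add: add_paths_def)

lemma mono_paths_Nil: "mono_paths s t ([] :: edge list) A' = []"
proof -
  have "fold (\<lambda>a. add_paths s t ([] :: edge list) (f a)) A' Ps = Ps" for f Ps
    by (induction A') (auto simp: add_paths_Nil)
  then show ?thesis
    by (simp add: mono_paths_def)
qed

lemma net_bs_eq_0: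
  assumes "s = t"
  shows "net G (char_flow (set bs)) s = 0"
proof (rule net_sink_zero)
  show "net G (char_flow (set bs)) v = 0" if "v \<in> verts G - {s}" for v
    using conserved_bs that assms unfolding conserved_def by simp
qed simp

lemma length_path_bound:
  assumes "0 \<le> net G (char_flow (set bs)) s"
  shows "real (length path_bound) = net G (char_flow (set bs)) s"
  using assms by (simp add: path_bound_def net_bs)

lemma flow_paths_correct:
  assumes "0 \<le> net G (char_flow (set bs)) s"
  shows "path_system (flow_paths s t A)" "set (concat (flow_paths s t A)) \<subseteq> set bs"
    "length (flow_paths s t A) = length path_bound"
    "s \<noteq> t \<Longrightarrow> \<exists>Qs. flow_paths s t A = Qs @ mono_paths s t path_bound A"
proof -
  have "path_system (flow_paths s t A) \<and> set (concat (flow_paths s t A)) \<subseteq> set bs \<and>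
    length (flow_paths s t A) = length path_bound \<and>
    (s \<noteq> t \<longrightarrow> (\<exists>Qs. flow_paths s t A = Qs @ mono_paths s t path_bound A))"
  proof (cases "s = t")
    case True
    then have "path_bound = []"
      using length_path_bound[OF assms] net_bs_eq_0 by simp
    moreover from this have "flow_paths s t A = []"
      by (simp add: flow_paths_eq add_paths_Nil mono_paths_Nil)
    moreover have "path_system []"
      by (simp add: path_system_def)
    ultimately show ?thesis
      using True by simp
  next
    case False
    note M = mono_paths_correct[OF False, of path_bound, unfolded mono_system_def]
    let ?M = "mono_paths s t path_bound A"
    obtain Qs where Qs: "add_paths s t path_bound (map (edge_of G) (rev bs)) ?M = Qs @ ?M"
      "path_system (Qs @ ?M)" "set (concat Qs) \<subseteq> set (rev bs)" "length (Qs @ ?M) \<le> length path_bound"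
      "length (Qs @ ?M) = length path_bound \<or> separated (set (rev bs) - set (concat (Qs @ ?M)))"
      by (rule add_paths_correct[of "rev bs" ?M path_bound]) (use False M bs_arcs in auto)
    have "flow_paths s t A = Qs @ ?M"
      by (simp add: flow_paths_eq edges_arc_data_of Qs(1))
    note Qs = this Qs(2-5)[folded this, unfolded set_rev]
    have sub: "set (concat (flow_paths s t A)) \<subseteq> set bs"
      using Qs(1,3) M by auto
    have "length (flow_paths s t A) = length path_bound"
      using Qs(5)
    proof
      assume "separated (set bs - set (concat (flow_paths s t A)))"
      then have "net G (char_flow (set bs)) s \<le> length (flow_paths s t A)"
        using Qs(2) sub conserved_bs False by (intro add_paths_separated)
      then show ?thesis
        using Qs(4) length_path_bound[OF assms] by simp
    qed
    then show ?thesis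
      using Qs sub by blast
  qed
  then show "path_system (flow_paths s t A)" "set (concat (flow_paths s t A)) \<subseteq> set bs"
    "length (flow_paths s t A) = length path_bound"
    "s \<noteq> t \<Longrightarrow> \<exists>Qs. flow_paths s t A = Qs @ mono_paths s t path_bound A"
    by auto
qed

lemma remaining_circulation:
  assumes "0 \<le> net G (char_flow (set bs)) s" "v \<in> verts G"
  shows "net G (char_flow (set bs - set (concat (flow_paths s t A)))) v = 0"
proof -
  note P = flow_paths_correct[OF assms(1)]
  define y where "y = char_flow (set bs - set (concat (flow_paths s t A)))"
  have "conserved y"
    unfolding y_def using P(1,2) conserved_bs by (intro conserved_diff conserved_path_system)
  then have cons: "net G y u = 0" if "u \<in> verts G - {s, t}" for u
    using that unfolding conserved_def by blast
  have s: "net G y s = 0"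
  proof (cases "s = t")
    case True
    show ?thesis
      by (rule net_sink_zero) (use cons True in auto)
  next
    case False
    have "net G y s = net G (char_flow (set bs)) s - net G (char_flow (set (concat (flow_paths s t A)))) s"
      unfolding y_def by (rule net_char_flow_diff[OF P(2)])
    then show ?thesis
      using net_path_system[OF P(1), of s] P(3) length_path_bound[OF assms(1)] False by simp
  qed
  have t: "net G y t = 0"
    by (rule net_sink_zero) (use cons s in auto)
  show ?thesis
    unfolding y_def[symmetric] using s t cons[of v] assms(2) by (cases "v = s \<or> v = t") auto
qed

lemma decomposition_correct:
  assumes "0 \<le> net G (char_flow (set bs)) s"
  shows "is_decomposition G s t x (weigh (flow_constant A) (flow_paths s t A),
    weigh (flow_constant A) (cycles (unused (flow_paths s t A) (edges A))))"
proof -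
  let ?Ps = "flow_paths s t A"
  define rs where "rs = rev (filter (\<lambda>a. a \<notin> set (concat ?Ps)) (rev bs))"
  define Cs where "Cs = cycles (unused ?Ps (edges A))"
  have rs: "set rs = set bs - set (concat ?Ps)"
    by (auto simp: rs_def)
  have Cs: "Cs = cycles (map (edge_of G) rs)"
    unfolding Cs_def edges_arc_data_of unused_edge_of rs_def ..
  have cyc: "\<forall>C\<in>set Cs. cycle C" "distinct (concat Cs)" "set (concat Cs) = set rs"
    unfolding Cs
    by (rule cycles_correct[OF fin_digraph_axioms, of rs];
        use bs_arcs rs remaining_circulation[OF assms] in auto)+
  note P = flow_paths_correct[OF assms]
  have const: "flow_constant A = l" if "bs \<noteq> []"
    using that set_bs by (intro flow_constant_arc_data_of) auto
  have empty: "?Ps = []" "Cs = []" if "bs = []"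
  proof -
    have "path_bound = []"
      using that by (simp add: path_bound_def edges_def out_edges_def)
    then show "?Ps = []"
      using P(3) by simp
    show "Cs = []"
      using that by (simp add: Cs_def edges_def unused_def cycles_def)
  qed
  show ?thesis
    unfolding is_decomposition_def Cs_def[symmetric] fst_conv snd_conv
  proof (intro conjI ballI)
    fix p
    assume "p \<in> set (weigh (flow_constant A) ?Ps)"
    then show "case p of (P, r) \<Rightarrow> apath s P t \<and> 0 < r"
      using P(1) const empty l_pos by (cases "bs = []") (auto simp: weigh_def path_system_def)
  next
    fix p
    assume "p \<in> set (weigh (flow_constant A) Cs)"
    then show "case p of (C, r) \<Rightarrow> cycle C \<and> 0 < r"
      using cyc(1) const empty l_pos by (cases "bs = []") (auto simp: weigh_def)
  next
    fix a
    assume "a \<in> arcs G"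
    then have "x a = l * of_bool (a \<in> set bs)"
      by (simp add: flow_eq char_flow_def)
    also have "\<dots> = flow_constant A * of_bool (a \<in> set (concat ?Ps)) + flow_constant A * of_bool (a \<in> set (concat Cs))"
      using const empty P(2) by (cases "bs = []") (auto simp: cyc(3) rs simp del: set_concat)
    also have "\<dots> = (\<Sum>(P, r)\<leftarrow>weigh (flow_constant A) ?Ps. const_flow P r a) +
        (\<Sum>(C, r)\<leftarrow>weigh (flow_constant A) Cs. const_flow C r a)"
      using P(1) cyc(2) by (simp only: sum_list_const_flow path_system_def)
    finally show "x a = (\<Sum>(P, r)\<leftarrow>weigh (flow_constant A) ?Ps. const_flow P r a) +
        (\<Sum>(C, r)\<leftarrow>weigh (flow_constant A) Cs. const_flow C r a)" .
  qed
qed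

lemma num_colours_le_2:
  assumes "set P \<subseteq> arcs G"
  shows "num_colours (colour I) P \<le> 2"
proof -
  have "card (colour I ` set P) \<le> card (colour I ` arcs G)"
    using assms by (intro card_mono) auto
  then show ?thesis
    using bichromatic by (simp add: num_colours_def bichromatic_def)
qed

lemma cost_flow_paths:
  assumes "0 \<le> net G (char_flow (set bs)) s" "s \<noteq> t"
  shows "(\<Sum>P\<leftarrow>flow_paths s t A. num_colours (colour I) P) + length (mono_paths s t path_bound A)
    \<le> 2 * length path_bound"
proof -
  note P = flow_paths_correct[OF assms(1)]
  note M = mono_paths_correct[OF assms(2), of path_bound, unfolded mono_system_def]
  obtain Qs where Qs: "flow_paths s t A = Qs @ mono_paths s t path_bound A"
    using P(4) assms(2) by blast
  have "(\<Sum>P\<leftarrow>Qs. num_colours (colour I) P) \<le> (\<Sum>P\<leftarrow>Qs. 2)"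
    using P(2) bs_arcs Qs by (intro sum_list_mono num_colours_le_2) auto
  moreover have "(\<Sum>P\<leftarrow>mono_paths s t path_bound A. num_colours (colour I) P)
      \<le> (\<Sum>P\<leftarrow>mono_paths s t path_bound A. 1)"
  proof (rule sum_list_mono)
    fix P
    assume "P \<in> set (mono_paths s t path_bound A)"
    then obtain c where "colour I ` set P \<subseteq> {c}"
      using M by blast
    then show "num_colours (colour I) P \<le> 1"
      using card_mono[of "{c}" "colour I ` set P"] by (simp add: num_colours_def)
  qed
  moreover have "length Qs + length (mono_paths s t path_bound A) = length path_bound"
    using P(3) Qs by simp
  ultimately show ?thesis
    by (simp add: Qs sum_list_triv)
qed

lemma decomposition_path:
  assumes "is_decomposition G s t x d" "s \<noteq> t" "p \<in> set (fst d)"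
  shows "fst p \<noteq> []" "set (fst p) \<subseteq> set bs" "0 < snd p" "snd p \<le> l"
proof -
  note D = is_decompositionD[OF assms(1)]
  have p: "apath s (fst p) t" "0 < snd p"
    using D(1)[OF assms(3)] by auto
  show ne: "fst p \<noteq> []"
    using p(1) assms(2) by (auto simp: apath_Nil_iff)
  show "0 < snd p"
    by (rule p(2))
  have le: "snd p \<le> x a" "a \<in> arcs G" if "a \<in> set (fst p)" for a
  proof -
    show a: "a \<in> arcs G"
      using p(1) that by (auto simp: apath_def)
    have nonneg: "0 \<le> const_flow (fst q) (snd q) a" if "q \<in> set (fst d) \<union> set (snd d)" for q
      using D(1)[of q] D(2)[of q] that by (auto simp: const_flow_def)
    obtain ys zs where "fst d = ys @ p # zs"
      using assms(3) by (auto simp: in_set_conv_decomp)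
    then have "x a = (\<Sum>q\<leftarrow>ys. const_flow (fst q) (snd q) a) + snd p +
        (\<Sum>q\<leftarrow>zs. const_flow (fst q) (snd q) a) + (\<Sum>q\<leftarrow>snd d. const_flow (fst q) (snd q) a)"
      using D(3)[OF a] that by (simp add: const_flow_def)
    moreover have "0 \<le> (\<Sum>q\<leftarrow>ys. const_flow (fst q) (snd q) a)"
      "0 \<le> (\<Sum>q\<leftarrow>zs. const_flow (fst q) (snd q) a)"
      "0 \<le> (\<Sum>q\<leftarrow>snd d. const_flow (fst q) (snd q) a)"
      using nonneg \<open>fst d = ys @ p # zs\<close> by (auto intro!: sum_list_nonneg)
    ultimately show "snd p \<le> x a"
      by simp
  qed
  have "x a = l" if "a \<in> set (fst p)" for a
    using le[OF that] p(2) uniform by (auto simp: uniform_flow_def)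
  then show "set (fst p) \<subseteq> set bs" "snd p \<le> l"
    using le ne by (auto simp: set_bs) (metis list.set_intros(1) neq_Nil_conv)
qed

lemma mono_part_le:
  assumes "is_decomposition G s t x d" "s \<noteq> t"
  shows "(\<Sum>p\<leftarrow>filter (\<lambda>p. colour I ` set (fst p) = {c}) (fst d). snd p / l)
    \<le> net G (char_flow (coloured_flow c)) s"
proof -
  note D = is_decompositionD[OF assms(1)] and path = decomposition_path[OF assms]
  let ?ps = "filter (\<lambda>p. colour I ` set (fst p) = {c}) (fst d)"
  define y where "y a = (\<Sum>p\<leftarrow>?ps. const_flow (fst p) (snd p / l) a)" for a
  have net_y: "net G y v = (\<Sum>p\<leftarrow>?ps. snd p / l) * (of_bool (s = v) - of_bool (t = v))" for v
  proof -
    have "net G y v = (\<Sum>p\<leftarrow>?ps. net G (const_flow (fst p) (snd p / l)) v)"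
      unfolding y_def by (rule net_sum_list)
    also have "\<dots> = (\<Sum>p\<leftarrow>?ps. snd p / l * (of_bool (s = v) - of_bool (t = v)))"
      using D(1) by (intro arg_cong[where f = sum_list] map_cong refl)
        (simp add: net_const_flow[where u = s and v = t])
    finally show ?thesis
      by (simp only: sum_list_mult_const)
  qed
  have y: "0 \<le> y a \<and> y a \<le> char_flow {a \<in> set bs. colour I a = c} a" if a: "a \<in> arcs G" for a
  proof
    have nonneg: "0 \<le> const_flow (fst p) (snd p / l) a" if "p \<in> set (fst d)" for p
      using path(3)[OF that] l_pos by (auto simp: const_flow_def)
    show "0 \<le> y a"
      unfolding y_def using nonneg by (intro sum_list_nonneg) auto
    show "y a \<le> char_flow {a \<in> set bs. colour I a = c} a"
    proof (cases "a \<in> set bs \<and> colour I a = c")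
      case True
      have "y a \<le> (\<Sum>p\<leftarrow>fst d. const_flow (fst p) (snd p / l) a)"
        unfolding y_def by (rule sum_list_filter_le) (rule nonneg)
      also have "\<dots> = (\<Sum>p\<leftarrow>fst d. const_flow (fst p) (snd p) a) / l"
      proof -
        have "(\<Sum>p\<leftarrow>ps. const_flow (fst p) (snd p / l) a) = (\<Sum>p\<leftarrow>ps. const_flow (fst p) (snd p) a) / l"
          for ps :: "(nat list \<times> real) list"
          by (induction ps) (auto simp: const_flow_def add_divide_distrib)
        then show ?thesis .
      qed
      also have "\<dots> \<le> x a / l"
      proof -
        have "0 \<le> (\<Sum>p\<leftarrow>snd d. const_flow (fst p) (snd p) a)"
          using D(2) by (intro sum_list_nonneg) (auto simp: const_flow_def less_imp_le)
        then show ?thesis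
          using D(3)[OF a] l_pos by (simp add: divide_right_mono)
      qed
      also have "x a / l = 1"
        using True l_pos by (simp add: set_bs)
      finally show ?thesis
        using True by (simp add: char_flow_def)
    next
      case False
      have "const_flow (fst p) (snd p / l) a = 0" if "p \<in> set ?ps" for p
        using that path(2)[of p] False by (auto simp: const_flow_def)
      then have "y a = (\<Sum>p\<leftarrow>?ps. 0)"
        unfolding y_def by (intro arg_cong[where f = sum_list] map_cong refl)
      then show ?thesis
        by (simp add: char_flow_def)
    qed
  qed
  have "unit_flow {a \<in> set bs. colour I a = c} y"
    unfolding unit_flow_def conserved_def using y by (auto simp: net_y)
  then have "net G y s \<le> net G (char_flow (coloured_flow c)) s"
    using max_unit_flow_coloured[OF assms(2)] by (simp add: max_unit_flow_def)
  then show ?thesis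
    using assms(2) by (simp add: net_y)
qed

lemma decomposition_cost_lower_bounds:
  assumes "is_decomposition G s t x d" "s \<noteq> t"
  shows "net G (char_flow (set bs)) s \<le> decomposition_cost (colour I) d"
    "2 * net G (char_flow (set bs)) s - (\<Sum>c\<in>colour I ` set bs. net G (char_flow (coloured_flow c)) s)
      \<le> decomposition_cost (colour I) d"
proof -
  let ?C = "colour I ` set bs" and ?k = "net G (char_flow (set bs)) s"
  let ?mono = "\<lambda>c p. colour I ` set (fst p) = {c}"
  note path = decomposition_path[OF assms]
  have "l * ?k = (\<Sum>p\<leftarrow>fst d. snd p)"
    using net_decomposition[OF assms(1), of s] assms(2) by (simp add: net_flow)
  then have k: "?k = (\<Sum>p\<leftarrow>fst d. snd p / l)"
  proof -
    have "l * (\<Sum>p\<leftarrow>fst d. snd p / l) = (\<Sum>p\<leftarrow>fst d. snd p)"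
      unfolding sum_list_const_mult[symmetric] using l_pos by simp
    then show ?thesis
      using \<open>l * ?k = _\<close> l_pos by (metis less_irrefl mult_left_cancel)
  qed
  have "real (\<Sum>p\<leftarrow>ps. f p) = (\<Sum>p\<leftarrow>ps. real (f p))" for ps :: "(nat list \<times> real) list" and f
    by (induction ps) auto
  then have cost: "real (decomposition_cost (colour I) d) = (\<Sum>p\<leftarrow>fst d. real (num_colours (colour I) (fst p)))"
    by (simp add: decomposition_cost_def case_prod_unfold)
  have pos: "1 \<le> num_colours (colour I) (fst p)" if "p \<in> set (fst d)" for p
    using path(1)[OF that] by (simp add: num_colours_def Suc_le_eq card_gt_0_iff)
  have ratio: "0 \<le> snd p / l" "snd p / l \<le> 1" if "p \<in> set (fst d)" for p
    using path(3,4)[OF that] l_pos by auto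
  show "?k \<le> decomposition_cost (colour I) d"
    unfolding k cost
  proof (rule sum_list_mono)
    fix p
    assume "p \<in> set (fst d)"
    then show "snd p / l \<le> real (num_colours (colour I) (fst p))"
      using ratio(2)[of p] pos[of p] by linarith
  qed
  have "2 * ?k - (\<Sum>c\<in>?C. net G (char_flow (coloured_flow c)) s) \<le>
      2 * (\<Sum>p\<leftarrow>fst d. snd p / l) - (\<Sum>c\<in>?C. \<Sum>p\<leftarrow>filter (?mono c) (fst d). snd p / l)"
    using mono_part_le[OF assms] by (simp only: k) (intro diff_left_mono sum_mono)
  also have "\<dots> = (\<Sum>p\<leftarrow>fst d. snd p / l * (2 - (\<Sum>c\<in>?C. of_bool (?mono c p))))"
    by (rule sum_list_sum_filter[symmetric]) simp
  also have "\<dots> \<le> (\<Sum>p\<leftarrow>fst d. real (num_colours (colour I) (fst p)))"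
  proof (rule sum_list_mono)
    fix p
    assume p: "p \<in> set (fst d)"
    show "snd p / l * (2 - (\<Sum>c\<in>?C. of_bool (?mono c p))) \<le> real (num_colours (colour I) (fst p))"
    proof (cases "\<exists>c. colour I ` set (fst p) = {c}")
      case True
      then obtain c where c: "colour I ` set (fst p) = {c}"
        by blast
      then have "c \<in> ?C"
        using path(2)[OF p] by auto
      then have "(\<Sum>c\<in>?C. of_bool (?mono c p)) = (1 :: real)"
        unfolding c by (simp add: of_bool_def)
      then show ?thesis
        using ratio(2)[OF p] c by (simp add: num_colours_def)
    next
      case False
      then have "num_colours (colour I) (fst p) \<noteq> 1"
        by (auto simp: num_colours_def card_1_singleton_iff)
      then have "2 \<le> real (num_colours (colour I) (fst p))"
        using pos[OF p] by linarith
      moreover have "snd p / l * (2 - (\<Sum>c\<in>?C. of_bool (?mono c p))) \<le> 1 * 2"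
        using mult_right_mono[OF ratio(2)[OF p], of 2] False by simp
      ultimately show ?thesis
        by simp
    qed
  qed
  finally show "2 * ?k - (\<Sum>c\<in>?C. net G (char_flow (coloured_flow c)) s)
      \<le> decomposition_cost (colour I) d"
    unfolding cost .
qed

theorem decompose_correct: "min_cost_cfd I (decompose s t A)"
proof (cases "0 \<le> net G (char_flow (set bs)) s")
  case True
  let ?d = "(weigh (flow_constant A) (flow_paths s t A),
    weigh (flow_constant A) (cycles (unused (flow_paths s t A) (edges A))))"
  have d: "decompose s t A = Some ?d"
    using True by (simp add: decompose_def net_bs)
  have cost: "decomposition_cost (colour I) ?d = (\<Sum>P\<leftarrow>flow_paths s t A. num_colours (colour I) P)"
    by (simp add: decomposition_cost_def sum_list_weigh)
  have "decomposition_cost (colour I) ?d \<le> decomposition_cost (colour I) d'"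
    if d': "is_decomposition G s t x d'" for d'
  proof (cases "s = t")
    case True
    have "flow_paths s t A = []"
      using flow_paths_correct(3) length_path_bound net_bs_eq_0[OF True] by simp
    then show ?thesis
      unfolding cost by simp
  next
    case False
    let ?M = "mono_paths s t path_bound A"
    have "length ?M = length path_bound \<or>
        (\<Sum>c\<in>colour I ` set bs. net G (char_flow (coloured_flow c)) s) \<le> length ?M"
      using mono_paths_correct[OF False, of path_bound] by (auto simp: mono_system_def)
    moreover have "real (decomposition_cost (colour I) ?d) + length ?M \<le> 2 * real (length path_bound)"
      using cost_flow_paths[OF True False] unfolding cost by linarith
    ultimately have "real (decomposition_cost (colour I) ?d) \<le> decomposition_cost (colour I) d'"
      using decomposition_cost_lower_bounds[OF d' False] length_path_bound[OF True] by auto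
    then show ?thesis
      by simp
  qed
  then show ?thesis
    using decomposition_correct[OF True] by (simp add: d is_min_cost_decomposition_def)
next
  case False
  have "decompose s t A = None"
    using False by (simp add: decompose_def net_bs)
  moreover have "\<not> is_decomposition G s t x d" for d
  proof
    assume d: "is_decomposition G s t x d"
    have "0 \<le> (\<Sum>p\<leftarrow>fst d. snd p)"
      using is_decompositionD(1)[OF d] by (intro sum_list_nonneg) (auto simp: less_imp_le)
    then have "0 \<le> l * net G (char_flow (set bs)) s"
      using net_decomposition[OF d, of s] by (simp add: net_flow)
    then show False
      using False l_pos by (simp add: zero_le_mult_iff)
  qed
  ultimately show ?thesis
    by simp
qed

end


type_synonym input = "nat list \<times> arc_data list \<times> nat \<times> nat \<times> nat \<times> unit"

definition input_of :: "cfd_instance \<Rightarrow> input" where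
  "input_of I = (sorted_list_of_set (verts (graph I)),
     map (arc_data_of I) (sorted_list_of_set (arcs (graph I))),
     ncolours I, source I, sink I, ())"

definition solve :: "input \<Rightarrow> nat decomposition option" where
  "solve z = decompose (fst (snd (snd (snd z)))) (fst (snd (snd (snd (snd z))))) (support (fst (snd z)))"

lemma encode_arc_data_of: "encode (arc_data_of I a) = enc_arc I a"
  by (simp add: arc_data_of_def enc_arc_def enc_list_def)

lemma encode_input_of: "encode (input_of I) = enc_instance I"
proof -
  have "encode (map (arc_data_of I) as) = enc_list (enc_arc I) as" for as
    by (induction as) (simp_all add: enc_list_def encode_arc_data_of del: encode_prod)
  then show ?thesis
    by (simp add: input_of_def enc_instance_def enc_list_def encode_list_eq)
qed

lemma encode_decomposition: "encode d = enc_option enc_decomposition d"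
proof -
  have "encode ps = enc_weighted_list ps" for ps
    unfolding enc_weighted_list_def encode_list_eq
    by (intro arg_cong2[where f = enc_list] refl ext) (auto simp: encode_list_eq)
  then show ?thesis
    by (cases d) (simp_all add: enc_decomposition_def)
qed

lemma ptime_solve: "ptime w solve"
  unfolding solve_def by (intro ptime_decompose ptime_intros)

lemma solve_correct:
  assumes "I \<in> cfd_instances" "bichromatic I" "0 < l" "uniform_flow (graph I) l (flow I)"
  shows "min_cost_cfd I (solve (input_of I))"
proof -
  interpret uniform_cfd I l
    using assms by unfold_locales
  show ?thesis
    using decompose_correct by (simp add: solve_def input_of_def support_arc_data_of bs_def)
qed

lemma poly_time_on_uniform_bichromatic:
  assumes "\<And>I. I \<in> K \<Longrightarrow> I \<in> cfd_instances \<and> bichromatic I \<and> (\<exists>l>0. uniform_flow (graph I) l (flow I))"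
  shows "min_cost_cfd_poly_time_on w K"
proof -
  obtain P q where Pq: "\<And>z. \<exists>n. exec w P (encode z) (encode (solve z)) n \<and>
     n + esize w (solve z) \<le> poly q (esize w z)"
    using ptime_solve by (rule ptimeE) blast
  have "\<exists>out n. exec w P (enc_instance I) (enc_option enc_decomposition out) n \<and>
      n \<le> poly q (ssize w (enc_instance I)) \<and> min_cost_cfd I out" if "I \<in> K" for I
  proof -
    obtain n where "exec w P (encode (input_of I)) (encode (solve (input_of I))) n"
      "n + esize w (solve (input_of I)) \<le> poly q (esize w (input_of I))"
      using Pq by blast
    moreover have "min_cost_cfd I (solve (input_of I))"
      using assms[OF that] solve_correct by blast
    ultimately show ?thesis
      unfolding encode_input_of encode_decomposition by (meson add_leD1)
  qed
  then show ?thesis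
    unfolding min_cost_cfd_poly_time_on_def poly_time_solvable_def by blast
qed

theorem theorem6:
  shows "min_cost_cfd_poly_time_on unit_size
      {I \<in> cfd_instances. bichromatic I \<and> (\<exists>l>0. uniform_flow (graph I) l (flow I))}
    \<and> min_cost_cfd_poly_time_on bit_size
      {I \<in> cfd_instances. bichromatic I \<and> (\<exists>l>0. uniform_flow (graph I) l (flow I))
         \<and> rational_instance I}"
  by (intro conjI poly_time_on_uniform_bichromatic) auto

end
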